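(* Let $G_{m,n}$ be an $m\times n$ grid graph, $m,n\ge 2$, and let $k\in\{2,3\}$. Then $$\|\Delta_k^t(G_{m,n})\|\simeq\bigvee_{\binom{(m-1)(n-1)}{k-1}}S^{mn-2k}.$$
   Context: Graphs are simple. The grid graph $G_{m,n}$ has vertex set $\{(i,j)\mid 1\le i\le m,\ 1\le j\le n\}$ and edges $\{(i,j),(i,j+1)\}$ for $1\le i\le m$, $1\le j\le n-1$, and $\{(i,j),(i+1,j)\}$ for $1\le i\le m-1$, $1\le j\le n$. For a graph $G$, the total $k$-cut complex $\Delta_k^t(G)$ is the simplicial complex consisting of all $W\subseteq V(G)$ such that $V(G)\setminus W$ contains an independent set of $G$ of size $k$. $\|K\|$ denotes the geometric realization of a simplicial complex $K$, $\simeq$ denotes homotopy equivalence, and $\bigvee_{N}S^{d}$ denotes a wedge sum of $N$ copies of the $d$-sphere. *)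

theory Defs
  imports "HOL-Analysis.Analysis"
begin

section \<open>Simple graphs\<close>

text \<open>A graph is a pair of a vertex set and a set of edges, an edge being a two-element vertex set.\<close>

type_synonym 'a graph = "'a set \<times> 'a set set"

abbreviation verts :: "'a graph \<Rightarrow> 'a set" where
  "verts \<equiv> fst"

abbreviation edges :: "'a graph \<Rightarrow> 'a set set" where
  "edges \<equiv> snd"

definition simple_graph :: "'a graph \<Rightarrow> bool" where
  "simple_graph G \<longleftrightarrow> (\<forall>e \<in> edges G. e \<subseteq> verts G \<and> card e = 2)"

definition independent_set :: "'a graph \<Rightarrow> 'a set \<Rightarrow> bool" where
  "independent_set G S \<longleftrightarrow> S \<subseteq> verts G \<and> (\<forall>u \<in> S. \<forall>v \<in> S. {u, v} \<notin> edges G)"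

definition grid_graph :: "nat \<Rightarrow> nat \<Rightarrow> (nat \<times> nat) graph" where
  "grid_graph m n =
     ({1..m} \<times> {1..n},
      {{(i, j), (i, j + 1)} | i j. 1 \<le> i \<and> i \<le> m \<and> 1 \<le> j \<and> j + 1 \<le> n} \<union>
      {{(i, j), (i + 1, j)} | i j. 1 \<le> i \<and> i + 1 \<le> m \<and> 1 \<le> j \<and> j \<le> n})"

lemma simple_graph_grid_graph: "simple_graph (grid_graph m n)"
  by (auto simp: simple_graph_def grid_graph_def)


section \<open>Abstract simplicial complexes\<close>

text \<open>The void complex \<open>{}\<close> is allowed; it differs from \<open>{{}}\<close>.\<close>

definition abstract_simplicial_complex :: "'a set set \<Rightarrow> bool" where
  "abstract_simplicial_complex K \<longleftrightarrow>
     (\<forall>\<sigma> \<in> K. finite \<sigma>) \<and> (\<forall>\<sigma> \<in> K. \<forall>\<tau>. \<tau> \<subseteq> \<sigma> \<longrightarrow> \<tau> \<in> K)"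

definition total_cut_complex :: "nat \<Rightarrow> 'a graph \<Rightarrow> 'a set set" where
  "total_cut_complex k G =
     {W. W \<subseteq> verts G \<and>
         (\<exists>S. S \<subseteq> verts G - W \<and> independent_set G S \<and> finite S \<and> card S = k)}"

lemma abstract_simplicial_complex_total_cut_complex:
  assumes "finite (verts G)"
  shows "abstract_simplicial_complex (total_cut_complex k G)"
  unfolding abstract_simplicial_complex_def total_cut_complex_def
  using assms by (blast intro: finite_subset)

text \<open>Points are given by barycentric coordinates.  The product topology used here is the
  coherent (weak) topology whenever \<open>K\<close> has finitely many vertices, but not in general.\<close>

definition geometric_realization :: "'a set set \<Rightarrow> ('a \<Rightarrow> real) topology" where
  "geometric_realization K =
     subtopology (powertop_real UNIV)
       {f. (\<forall>v. 0 \<le> f v) \<and> {v. f v \<noteq> 0} \<in> K \<and> (\<Sum>v | f v \<noteq> 0. f v) = 1}"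


section \<open>Wedge sums\<close>

text \<open>The point \<open>None\<close> is the common base point of the wedge; every other point \<open>Some (i, x)\<close>
  is a point \<open>x\<close>, different from the base point, of the \<open>i\<close>-th summand.\<close>

definition wedge_inclusion :: "('i \<Rightarrow> 'a) \<Rightarrow> 'i \<Rightarrow> 'a \<Rightarrow> ('i \<times> 'a) option" where
  "wedge_inclusion b i x = (if x = b i then None else Some (i, x))"

text \<open>The empty wedge is a single point.\<close>

definition wedge_sum ::
    "('i \<Rightarrow> 'a topology) \<Rightarrow> ('i \<Rightarrow> 'a) \<Rightarrow> 'i set \<Rightarrow> ('i \<times> 'a) option topology" where
  "wedge_sum X b I =
     topology (\<lambda>U. U \<subseteq> insert None (\<Union>i \<in> I. wedge_inclusion b i ` topspace (X i)) \<and>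
                   (\<forall>i \<in> I. openin (X i) {x \<in> topspace (X i). wedge_inclusion b i x \<in> U}))"

lemma istopology_wedge_sum:
  "istopology (\<lambda>U. U \<subseteq> insert None (\<Union>i \<in> I. wedge_inclusion b i ` topspace (X i)) \<and>
                   (\<forall>i \<in> I. openin (X i) {x \<in> topspace (X i). wedge_inclusion b i x \<in> U}))"
proof -
  have inter: "{x \<in> topspace (X i). wedge_inclusion b i x \<in> S \<inter> T} =
      {x \<in> topspace (X i). wedge_inclusion b i x \<in> S} \<inter>
      {x \<in> topspace (X i). wedge_inclusion b i x \<in> T}" for i S T
    by auto
  have union: "{x \<in> topspace (X i). wedge_inclusion b i x \<in> \<Union>\<K>} =
      (\<Union>S \<in> \<K>. {x \<in> topspace (X i). wedge_inclusion b i x \<in> S})" for i \<K>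
    by auto
  show ?thesis
    unfolding istopology_def inter union
    by (intro conjI allI impI ballI openin_Int openin_Union) auto
qed

lemma openin_wedge_sum:
  "openin (wedge_sum X b I) U \<longleftrightarrow>
     U \<subseteq> insert None (\<Union>i \<in> I. wedge_inclusion b i ` topspace (X i)) \<and>
     (\<forall>i \<in> I. openin (X i) {x \<in> topspace (X i). wedge_inclusion b i x \<in> U})"
  by (simp add: wedge_sum_def istopology_wedge_sum)

lemma topspace_wedge_sum:
  "topspace (wedge_sum X b I) = insert None (\<Union>i \<in> I. wedge_inclusion b i ` topspace (X i))"
    (is "_ = ?C")
proof
  show "topspace (wedge_sum X b I) \<subseteq> ?C"
    using openin_wedge_sum[of X b I "topspace (wedge_sum X b I)"] by simp
  have "{x \<in> topspace (X i). wedge_inclusion b i x \<in> ?C} = topspace (X i)" if "i \<in> I" for i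
    using that by auto
  then have "openin (wedge_sum X b I) ?C"
    by (simp add: openin_wedge_sum del: insert_iff)
  then show "?C \<subseteq> topspace (wedge_sum X b I)"
    by (rule openin_subset)
qed

lemma quotient_map_wedge_sum:
  assumes "I \<noteq> {}" and "\<And>i. i \<in> I \<Longrightarrow> b i \<in> topspace (X i)"
  shows "quotient_map (sum_topology X I) (wedge_sum X b I) (\<lambda>(i, x). wedge_inclusion b i x)"
proof -
  obtain i where i: "i \<in> I"
    using assms(1) by blast
  then have "None \<in> wedge_inclusion b i ` topspace (X i)"
    using assms(2) by (force simp: wedge_inclusion_def)
  with i have img: "(\<lambda>(i, x). wedge_inclusion b i x) ` topspace (sum_topology X I) =
      topspace (wedge_sum X b I)"
    unfolding topspace_wedge_sum topspace_sum_topology by (auto simp: image_iff split: prod.splits) blast+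
  have "openin (sum_topology X I)
      {p \<in> topspace (sum_topology X I). (case p of (i, x) \<Rightarrow> wedge_inclusion b i x) \<in> U} \<longleftrightarrow>
      openin (wedge_sum X b I) U" if "U \<subseteq> topspace (wedge_sum X b I)" for U
  proof -
    have "openin (X i) {x. (i, x) \<in> {p \<in> topspace (sum_topology X I).
             (case p of (i, x) \<Rightarrow> wedge_inclusion b i x) \<in> U}} \<longleftrightarrow>
          openin (X i) {x \<in> topspace (X i). wedge_inclusion b i x \<in> U}" if "i \<in> I" for i
      using that by simp
    then show ?thesis
      using that unfolding openin_sum_topology openin_wedge_sum topspace_wedge_sum by auto
  qed
  with img show ?thesis
    unfolding quotient_map_def by blast
qed

definition nsphere_base :: "nat \<Rightarrow> real" where
  "nsphere_base = (\<lambda>i. if i = 0 then 1 else 0)"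

lemma nsphere_base_in_nsphere: "nsphere_base \<in> topspace (nsphere d)"
  by (simp add: nsphere nsphere_base_def if_distrib[of "\<lambda>x. x ^ 2"] cong: if_cong)

text \<open>The dimension is an integer.  A sphere of negative dimension is empty, hence has no base
  point; by convention a wedge of any number (also zero) of such spheres is the empty space.
  This matches the empty realization of the void complex.\<close>

definition wedge_of_spheres :: "nat \<Rightarrow> int \<Rightarrow> (nat \<times> (nat \<Rightarrow> real)) option topology" where
  "wedge_of_spheres N d =
     (if d < 0 then trivial_topology
      else wedge_sum (\<lambda>_. nsphere (nat d)) (\<lambda>_. nsphere_base) {..<N})"

end

theory Submission
  imports Defs
begin

text \<open>
  A face \<open>W\<close> is described by its complement \<open>U\<close>, which contains an independent set of size \<open>k\<close>.
  Discrete Morse theory: first match \<open>U\<close> by toggling the corner \<open>(1, 1)\<close>.  For the sets \<open>T\<close> that are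
  left, let \<open>x\<close> be the lexicographically largest vertex of \<open>T\<close>, and match by toggling the parent of \<open>x\<close>
  in the spanning tree formed by all vertical edges and the edges of the first row; this works
  unless \<open>T\<close> contains the horizontal edge that ends in \<open>x\<close>, not in the first row.
  For \<open>k = 2\<close> then \<open>T\<close> is this edge, and is critical; for \<open>k = 3\<close> the same step is repeated for the
  rest of \<open>T\<close>.  The critical sets correspond to the \<open>(k - 1)\<close>-subsets of the \<open>(m - 1) * (n - 1)\<close> edges
  outside the spanning tree, and all have \<open>2 * k - 1\<close> elements.  As all critical faces have the same
  dimension \<open>d\<close>, the complex collapses to one obtained from a collapsible complex by adding \<open>d\<close>-simplices,
  and shrinking the contractible part to a point gives a wedge of spheres.
\<close>

section \<open>Geometric realizations and elementary collapses\<close>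

text \<open>Toggling a vertex in the complement toggles it in the face, so the matching can be
  described on complements, with inclusions reversed. The parent is the right vertex to toggle
  because the largest vertex \<open>x\<close> of \<open>T\<close> has at most a left and an upper
  neighbour in \<open>T\<close>. If only the parent can occur there, \<open>x\<close> and its parent
  are interchangeable in stable sets, so the conditions on \<open>T\<close> do not feel the presence
  of the parent. A horizontal edge into \<open>x\<close> outside the first row is exactly what
  breaks this exchange. Acyclicity is never checked along paths. A rank that is monotone under
  inclusion and determines the vertex to be toggled suffices: among the faces larger than all
  critical ones, take those of maximal cardinality and among these one of maximal rank; its partner
  is a free face. The case \<open>m = n = 2\<close>, \<open>k = 3\<close> stands apart: the complex
  is void, the dimension is -2, and both sides are empty. In all other cases
  \<open>V - {corner}\<close> contains a stable set of size \<open>k\<close>, so the empty face is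
  matched, and this anchors the collapse of the noncritical part to a point.\<close>

definition realization_points :: "'a set set \<Rightarrow> ('a \<Rightarrow> real) set" where
  "realization_points K =
     {f. (\<forall>v. 0 \<le> f v) \<and> {v. f v \<noteq> 0} \<in> K \<and> (\<Sum>v | f v \<noteq> 0. f v) = 1}"

definition std_simplex :: "'a set \<Rightarrow> ('a \<Rightarrow> real) set" where
  "std_simplex \<sigma> = {f. (\<forall>v. 0 \<le> f v) \<and> {v. f v \<noteq> 0} \<subseteq> \<sigma> \<and> sum f \<sigma> = 1}"

text \<open>One function with two uses: the amount that can be moved off every vertex of a face in a
  collapse, and a function on a simplex that vanishes exactly on the boundary and is largest at the
  barycentre.\<close>

definition min_coord :: "'a set \<Rightarrow> ('a \<Rightarrow> real) \<Rightarrow> real" where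
  "min_coord \<sigma> f = Min (f ` \<sigma>)"

text \<open>The product topology on all real functions is their type class topology, so
  \<open>continuous_on\<close>, \<open>closed\<close> and \<open>compact\<close> apply to
  realizations.\<close>

lemma geometric_realization_eq: "geometric_realization K = top_of_set (realization_points K)"
  by (simp add: geometric_realization_def realization_points_def euclidean_product_topology)

lemma std_simplex_iff:
  assumes "finite \<sigma>"
  shows "f \<in> std_simplex \<sigma> \<longleftrightarrow>
    (\<forall>v. 0 \<le> f v) \<and> {v. f v \<noteq> 0} \<subseteq> \<sigma> \<and> (\<Sum>v | f v \<noteq> 0. f v) = 1"
proof -
  have "{v. f v \<noteq> 0} \<subseteq> \<sigma> \<Longrightarrow> sum f \<sigma> = (\<Sum>v | f v \<noteq> 0. f v)"
    using assms by (intro sum.mono_neutral_right) auto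
  then show ?thesis by (auto simp: std_simplex_def)
qed

lemma realization_points_Union:
  assumes "abstract_simplicial_complex K"
  shows "realization_points K = (\<Union>\<sigma>\<in>K. std_simplex \<sigma>)"
proof -
  have fin: "finite \<sigma>" if "\<sigma> \<in> K" for \<sigma>
    using assms that by (auto simp: abstract_simplicial_complex_def)
  have sub: "\<tau> \<in> K" if "\<sigma> \<in> K" "\<tau> \<subseteq> \<sigma>" for \<sigma> \<tau>
    using assms that by (auto simp: abstract_simplicial_complex_def)
  show ?thesis
  proof (intro equalityI subsetI)
    fix f assume f: "f \<in> realization_points K"
    then have "{v. f v \<noteq> 0} \<in> K" by (simp add: realization_points_def)
    moreover have "f \<in> std_simplex {v. f v \<noteq> 0}"
      using f by (simp add: realization_points_def std_simplex_def)
    ultimately show "f \<in> (\<Union>\<sigma>\<in>K. std_simplex \<sigma>)" by blast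
  next
    fix f assume "f \<in> (\<Union>\<sigma>\<in>K. std_simplex \<sigma>)"
    then obtain \<sigma> where "\<sigma> \<in> K" "f \<in> std_simplex \<sigma>" by blast
    then show "f \<in> realization_points K"
      using fin sub by (auto simp: std_simplex_iff realization_points_def)
  qed
qed

lemma continuous_on_min_coord:
  assumes "finite \<sigma>" "\<sigma> \<noteq> {}"
  shows "continuous_on S (min_coord \<sigma>)"
  unfolding min_coord_def using assms
proof (induction rule: finite_ne_induct)
  case (singleton v)
  then show ?case
    by (auto intro: continuous_on_subset[OF continuous_on_product_coordinates])
next
  case (insert v F)
  have "continuous_on S (\<lambda>f. min (f v) (Min (f ` F)))"
    by (intro continuous_on_min insert)
       (auto intro: continuous_on_subset[OF continuous_on_product_coordinates])
  then show ?case
    using insert by simp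
qed

lemma min_coord_le: "finite \<sigma> \<Longrightarrow> v \<in> \<sigma> \<Longrightarrow> min_coord \<sigma> f \<le> f v"
  by (simp add: min_coord_def)

lemma min_coord_attained:
  assumes "finite \<sigma>" "\<sigma> \<noteq> {}"
  obtains v where "v \<in> \<sigma>" "f v = min_coord \<sigma> f"
proof -
  have "min_coord \<sigma> f \<in> f ` \<sigma>"
    unfolding min_coord_def by (rule Min_in) (use assms in auto)
  then show ?thesis using that by force
qed

lemma min_coord_eq_0:
  assumes "finite \<sigma>" "v \<in> \<sigma>" "f v = 0" "\<And>v. 0 \<le> f v"
  shows "min_coord \<sigma> f = 0"
proof -
  obtain w where "w \<in> \<sigma>" "f w = min_coord \<sigma> f"
    using min_coord_attained assms by (metis empty_iff)
  then show ?thesis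
    using assms min_coord_le by (metis antisym)
qed

text \<open>The deformation moves the same amount from every vertex of \<open>\<sigma>\<close> to \<open>v\<close>, until the first
  coordinate on \<open>\<sigma>\<close> vanishes.\<close>

lemma elementary_collapse:
  fixes K :: "'a set set"
  assumes K: "abstract_simplicial_complex K"
    and "\<sigma> \<noteq> {}" and v: "v \<notin> \<sigma>" and \<sigma>: "\<sigma> \<in> K" and \<tau>: "insert v \<sigma> \<in> K"
    and free: "\<And>\<rho>. \<rho> \<in> K \<Longrightarrow> \<sigma> \<subseteq> \<rho> \<Longrightarrow> \<rho> = \<sigma> \<or> \<rho> = insert v \<sigma>"
  shows "geometric_realization K homotopy_equivalent_space
         geometric_realization (K - {\<sigma>, insert v \<sigma>})"
proof -
  define K' where "K' = K - {\<sigma>, insert v \<sigma>}"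
  have fin: "finite \<rho>" if "\<rho> \<in> K" for \<rho>
    using K that by (auto simp: abstract_simplicial_complex_def)
  have sub: "\<rho>' \<in> K" if "\<rho> \<in> K" "\<rho>' \<subseteq> \<rho>" for \<rho> \<rho>'
    using K that by (auto simp: abstract_simplicial_complex_def)
  have fin\<sigma>: "finite \<sigma>" using fin \<sigma> by blast
  have K': "abstract_simplicial_complex K'"
    unfolding abstract_simplicial_complex_def
  proof (intro conjI ballI allI impI)
    show "finite \<rho>" if "\<rho> \<in> K'" for \<rho> using that fin by (auto simp: K'_def)
    fix \<rho> \<rho>' assume \<rho>: "\<rho> \<in> K'" "\<rho>' \<subseteq> \<rho>"
    have "\<not> \<sigma> \<subseteq> \<rho>" using free \<rho> by (auto simp: K'_def)
    then show "\<rho>' \<in> K'" using sub \<rho> by (auto simp: K'_def)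
  qed
  let ?X = "realization_points K" and ?Y = "realization_points K'"
  have YX: "?Y \<subseteq> ?X" by (auto simp: realization_points_def K'_def)
  define \<mu> where "\<mu> = (min_coord \<sigma> :: ('a \<Rightarrow> real) \<Rightarrow> real)"
  define D :: "real \<times> ('a \<Rightarrow> real) \<Rightarrow> 'a \<Rightarrow> real" where
    "D = (\<lambda>(t, f) w. f w - (if w \<in> \<sigma> then t * \<mu> f else 0) +
                       (if w = v then t * (card \<sigma> * \<mu> f) else 0))"
  have \<mu>0: "0 \<le> \<mu> f" if "\<And>w. 0 \<le> f w" for f
    using min_coord_attained[OF fin\<sigma> \<open>\<sigma> \<noteq> {}\<close>] that unfolding \<mu>_def by metis
  have \<mu>le: "\<mu> f \<le> f w" if "w \<in> \<sigma>" for f w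
    using that fin\<sigma> by (simp add: \<mu>_def min_coord_le)
  have D_fix: "D (t, f) = f" if "\<mu> f = 0" for t f
    using that by (auto simp: D_def)
  have D_simplex: "D (t, f) \<in> std_simplex \<rho>"
    if "f \<in> std_simplex \<rho>" "t \<in> {0..1}" "insert v \<sigma> \<subseteq> \<rho>" "finite \<rho>" for t f \<rho>
  proof -
    have nn: "0 \<le> f w" for w using that by (simp add: std_simplex_def)
    have "t * \<mu> f \<le> \<mu> f" using that \<mu>0[OF nn] by (auto intro: mult_left_le_one_le)
    then have *: "t * \<mu> f \<le> f w" if "w \<in> \<sigma>" for w using \<mu>le[OF that, of f] by linarith
    have "0 \<le> D (t, f) w" for w
      using *[of w] nn[of w] \<mu>0[OF nn] that(2) v by (auto simp: D_def)
    moreover have "{w. D (t, f) w \<noteq> 0} \<subseteq> \<rho>"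
      using that by (auto simp: D_def std_simplex_def)
    moreover have "sum (D (t, f)) \<rho> = 1"
    proof -
      have "(\<Sum>w\<in>\<rho>. if w \<in> \<sigma> then t * \<mu> f else 0) = card \<sigma> * (t * \<mu> f)"
        using that by (simp add: sum.If_cases Int_absorb1)
      moreover have "(\<Sum>w\<in>\<rho>. if w = v then t * (card \<sigma> * \<mu> f) else 0) = t * (card \<sigma> * \<mu> f)"
        using that by (simp add: sum.delta)
      ultimately show ?thesis
        using that by (simp add: D_def sum.distrib sum_subtractf std_simplex_def)
    qed
    ultimately show ?thesis by (auto simp: std_simplex_def)
  qed
  \<comment> \<open>Where \<open>\<mu>\<close> vanishes, \<open>D\<close> is the identity. Elsewhere
    the support contains \<open>\<sigma>\<close>, so freeness puts the point into the simplex
    \<open>insert v \<sigma>\<close>, the only place where anything moves.\<close>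
  have supp: "f \<in> std_simplex (insert v \<sigma>)" if "f \<in> ?X" "\<mu> f \<noteq> 0" for f
  proof -
    have "\<sigma> \<subseteq> {w. f w \<noteq> 0}"
      using that min_coord_eq_0[OF fin\<sigma>, of _ f] by (auto simp: realization_points_def \<mu>_def)
    then have "{w. f w \<noteq> 0} \<subseteq> insert v \<sigma>"
      using free[of "{w. f w \<noteq> 0}"] that(1) by (auto simp: realization_points_def)
    then show ?thesis
      using that(1) fin\<sigma> by (auto simp: realization_points_def std_simplex_iff)
  qed
  have DX: "D (t, f) \<in> ?X" if "f \<in> ?X" "t \<in> {0..1}" for t f
  proof (cases "\<mu> f = 0")
    case False
    then have "D (t, f) \<in> std_simplex (insert v \<sigma>)"
      using D_simplex supp that fin\<sigma> by blast
    then show ?thesis using \<tau> K by (auto simp: realization_points_Union)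
  qed (use that D_fix in simp)
  have D1: "D (1, f) \<in> ?Y" if "f \<in> ?X" for f
  proof -
    have X1: "D (1, f) \<in> ?X" using DX that by simp
    obtain w where w: "w \<in> \<sigma>" "f w = \<mu> f"
      using min_coord_attained[OF fin\<sigma> \<open>\<sigma> \<noteq> {}\<close>] unfolding \<mu>_def by metis
    then have "D (1, f) w = 0" using v by (auto simp: D_def)
    then have "{w. D (1, f) w \<noteq> 0} \<notin> {\<sigma>, insert v \<sigma>}" using w by auto
    then show ?thesis using X1 by (simp add: realization_points_def K'_def)
  qed
  have D_Y: "D (t, f) = f" if "f \<in> ?Y" for t f
  proof -
    have "\<not> \<sigma> \<subseteq> {w. f w \<noteq> 0}"
      using free[of "{w. f w \<noteq> 0}"] that by (auto simp: realization_points_def K'_def)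
    then have "\<mu> f = 0"
      using min_coord_eq_0[OF fin\<sigma>, of _ f] that by (auto simp: realization_points_def \<mu>_def)
    then show ?thesis by (rule D_fix)
  qed
  have cont: "continuous_on ({0..1} \<times> ?X) D"
  proof (rule continuous_on_coordinatewise_then_product)
    fix w
    have c1: "continuous_on ({0..1} \<times> ?X) (\<lambda>p. snd p w')" for w'
      by (rule continuous_on_product_then_coordinatewise) (intro continuous_intros)
    have c2: "continuous_on ({0..1} \<times> ?X) (\<lambda>p. \<mu> (snd p))"
      unfolding \<mu>_def
      by (rule continuous_on_compose2[OF continuous_on_min_coord[OF fin\<sigma> \<open>\<sigma> \<noteq> {}\<close>, where S = UNIV], where f = snd])
         (auto intro: continuous_intros)
    show "continuous_on ({0..1} \<times> ?X) (\<lambda>p. D p w)"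
      unfolding D_def case_prod_unfold
      by (cases "w \<in> \<sigma>"; cases "w = v"; simp; intro continuous_intros c1 c2)
  qed
  have hom: "homotopic_with (\<lambda>x. True) (top_of_set ?X) (top_of_set ?X) (\<lambda>f. D (1, f)) id"
    unfolding homotopic_with_sym[of _ _ _ _ id]
    unfolding homotopic_with_def
    by (rule exI[of _ D]) (use cont DX in \<open>auto simp: D_def\<close>)
  have "retraction_maps (top_of_set ?X) (top_of_set ?Y) (\<lambda>f. D (1, f)) id"
    unfolding retraction_maps_def
  proof (intro conjI)
    have "continuous_on ?X (\<lambda>f. D (1, f))"
      by (rule continuous_on_compose2[OF cont]) (auto intro!: continuous_intros)
    then show "continuous_map (top_of_set ?X) (top_of_set ?Y) (\<lambda>f. D (1, f))"
      using D1 by auto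
    show "continuous_map (top_of_set ?Y) (top_of_set ?X) id"
      using YX by auto
  qed (use D_Y in auto)
  with hom show ?thesis
    unfolding geometric_realization_eq K'_def[symmetric]
    by (rule deformation_retract_imp_homotopy_equivalent_space)
qed

section \<open>Quotients by contractible subcomplexes\<close>

lemma quotient_map_lift:
  assumes "quotient_map X Y q" "continuous_map X Z h"
    and "\<forall>x\<in>topspace X. \<forall>y\<in>topspace X. q x = q y \<longrightarrow> h x = h y"
  shows "\<exists>g. continuous_map Y Z g \<and> (\<forall>x\<in>topspace X. g (q x) = h x)"
proof -
  obtain g where "continuous_map Y Z g" "\<And>x. x \<in> topspace X \<Longrightarrow> g (q x) = h x"
    by (rule quotient_map_lift_exists[OF assms(1,2)]) (use assms(3) in blast)+
  then show ?thesis by blast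
qed

text \<open>\<open>H (1, _)\<close> is constant on the fibres of \<open>q\<close> and so descends to
  a map \<open>g\<close> from \<open>Y\<close> back to \<open>X\<close>; \<open>H\<close> itself
  joins the identity to \<open>g \<circ> q\<close>. Since \<open>H\<close> respects fibres at all
  times, \<open>q \<circ> H\<close> descends to a homotopy on \<open>Y\<close> from the identity to
  \<open>q \<circ> g\<close>.\<close>

lemma quotient_homotopy_equivalence:
  fixes H :: "real \<times> 'a \<Rightarrow> 'a"
  assumes q: "quotient_map X Y q"
    and H: "continuous_map (prod_topology (top_of_set {0..1}) X) X H"
    and H0: "\<And>x. x \<in> topspace X \<Longrightarrow> H (0, x) = x"
    and Ht: "\<And>t x y. \<lbrakk>t \<in> {0..1}; x \<in> topspace X; y \<in> topspace X; q x = q y\<rbrakk> \<Longrightarrow>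
                q (H (t, x)) = q (H (t, y))"
    and H1: "\<And>x y. \<lbrakk>x \<in> topspace X; y \<in> topspace X; q x = q y\<rbrakk> \<Longrightarrow> H (1, x) = H (1, y)"
  shows "X homotopy_equivalent_space Y"
proof -
  let ?I = "top_of_set {0..1::real}"
  have cq: "continuous_map X Y q" and sq: "q ` topspace X = topspace Y"
    using q by (auto simp: quotient_imp_continuous_map quotient_imp_surjective_map)
  define h where "h = (\<lambda>x. H (1, x))"
  have "continuous_map X X (H \<circ> (\<lambda>x. (1, x)))"
    by (rule continuous_map_compose[OF _ H]) (auto intro!: continuous_map_pairedI)
  then have h: "continuous_map X X h"
    by (simp add: h_def o_def)
  have "\<forall>x\<in>topspace X. \<forall>y\<in>topspace X. q x = q y \<longrightarrow> h x = h y"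
    unfolding h_def by (blast intro: H1)
  then obtain g where g: "continuous_map Y X g" and gq: "\<And>x. x \<in> topspace X \<Longrightarrow> g (q x) = h x"
    using quotient_map_lift[OF q h] by blast
  \<comment> \<open>A product of a quotient map with an identity need not be a quotient map; local
    compactness of the interval makes it one, so that the homotopy can descend.\<close>
  have "locally_compact_space ?I"
    by (simp add: compact_imp_locally_compact_space compact_space_subtopology)
  then have qI: "quotient_map (prod_topology ?I X) (prod_topology ?I Y) (\<lambda>(t, x). (t, q x))"
    by (intro quotient_map_prod_right q) (auto intro: Hausdorff_space_subtopology)
  have qH: "continuous_map (prod_topology ?I X) Y (q \<circ> H)"
    by (rule continuous_map_compose[OF H cq])
  have "\<forall>p\<in>topspace (prod_topology ?I X). \<forall>p'\<in>topspace (prod_topology ?I X).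
      (\<lambda>(t, x). (t, q x)) p = (\<lambda>(t, x). (t, q x)) p' \<longrightarrow> (q \<circ> H) p = (q \<circ> H) p'"
    by (auto intro: Ht)
  then obtain G where G: "continuous_map (prod_topology ?I Y) Y G"
    and Gq: "\<And>p. p \<in> topspace (prod_topology ?I X) \<Longrightarrow> G ((\<lambda>(t, x). (t, q x)) p) = (q \<circ> H) p"
    using quotient_map_lift[OF qI qH] by blast
  have Gq': "G (t, q x) = q (H (t, x))" if "t \<in> {0..1}" "x \<in> topspace X" for t x
    using Gq[of "(t, x)"] that by simp
  have "homotopic_with (\<lambda>x. True) X X id (g \<circ> q)"
    unfolding homotopic_with[where P = "\<lambda>x. True", OF refl]
    using H H0 gq by (intro exI[of _ H]) (simp add: h_def)
  moreover have "homotopic_with (\<lambda>x. True) Y Y id (q \<circ> g)"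
    unfolding homotopic_with[where P = "\<lambda>x. True", OF refl]
  proof (intro exI[of _ G] conjI ballI)
    fix y assume "y \<in> topspace Y"
    then obtain x where x: "x \<in> topspace X" "y = q x" using sq by blast
    show "G (0, y) = id y" using Gq'[of 0 x] x H0 by simp
    show "G (1, y) = (q \<circ> g) y" using Gq'[of 1 x] x gq by (simp add: h_def)
  qed (use G in auto)
  ultimately show ?thesis
    unfolding homotopy_equivalent_space_def using g cq homotopic_with_sym by metis
qed

section \<open>A simplex modulo its boundary is a sphere\<close>

lemma std_simplex_outside: "f \<in> std_simplex \<sigma> \<Longrightarrow> v \<notin> \<sigma> \<Longrightarrow> f v = 0"
  by (auto simp: std_simplex_def)

lemma min_coord_affine:
  assumes "finite \<sigma>" "\<sigma> \<noteq> {}" "0 \<le> b" and eq: "\<And>w. w \<in> \<sigma> \<Longrightarrow> f w = a + b * g w"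
  shows "min_coord \<sigma> f = a + b * min_coord \<sigma> g"
proof (rule antisym)
  obtain w where w: "w \<in> \<sigma>" "g w = min_coord \<sigma> g" using min_coord_attained assms by metis
  then show "min_coord \<sigma> f \<le> a + b * min_coord \<sigma> g"
    using min_coord_le[OF assms(1) w(1), of f] eq by simp
  obtain w where w: "w \<in> \<sigma>" "f w = min_coord \<sigma> f" using min_coord_attained assms by metis
  then show "a + b * min_coord \<sigma> g \<le> min_coord \<sigma> f"
    using min_coord_le[OF assms(1) w(1), of g] eq[of w] \<open>0 \<le> b\<close> mult_left_mono by fastforce
qed

text \<open>With \<open>\<sigma> = e ` {..d}\<close>, the interior of the simplex is identified with a \<open>d\<close>-dimensional
  Euclidean space by the coordinates \<open>(f (e j) - f (e 0)) / \<mu>\<close>, where \<open>\<mu>\<close> is the least barycentric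
  coordinate; inverse stereographic projection from \<open>nsphere_base\<close> follows.  After clearing \<open>\<mu>\<close>
  from the denominators the formula extends to the boundary \<open>\<mu> = 0\<close>.\<close>

definition sphere_map :: "(nat \<Rightarrow> 'a) \<Rightarrow> nat \<Rightarrow> ('a \<Rightarrow> real) \<Rightarrow> nat \<Rightarrow> real" where
  "sphere_map e d f =
     (let \<mu> = min_coord (e ` {..d}) f; A = (\<Sum>j\<in>{1..d}. (f (e j) - f (e 0))\<^sup>2)
      in (\<lambda>j. if j = 0 then (A - \<mu>\<^sup>2) / (A + \<mu>\<^sup>2)
              else if j \<le> d then 2 * \<mu> * (f (e j) - f (e 0)) / (A + \<mu>\<^sup>2) else 0))"

context
  fixes e :: "nat \<Rightarrow> 'a" and d :: nat and \<sigma> :: "'a set"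
  assumes e: "bij_betw e {..d} \<sigma>"
begin

lemma enum_image: "e ` {..d} = \<sigma>" and enum_finite: "finite \<sigma>" and enum_nonempty: "\<sigma> \<noteq> {}"
  using e bij_betw_finite by (auto simp: bij_betw_def)

lemma sphere_map_0: "sphere_map e d f 0 =
    ((\<Sum>j\<in>{1..d}. (f (e j) - f (e 0))\<^sup>2) - (min_coord \<sigma> f)\<^sup>2) /
    ((\<Sum>j\<in>{1..d}. (f (e j) - f (e 0))\<^sup>2) + (min_coord \<sigma> f)\<^sup>2)"
  by (simp add: sphere_map_def Let_def enum_image)

lemma sphere_map_pos: "j \<noteq> 0 \<Longrightarrow> j \<le> d \<Longrightarrow> sphere_map e d f j =
    2 * min_coord \<sigma> f * (f (e j) - f (e 0)) /
    ((\<Sum>j\<in>{1..d}. (f (e j) - f (e 0))\<^sup>2) + (min_coord \<sigma> f)\<^sup>2)"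
  by (simp add: sphere_map_def Let_def enum_image)

lemma sphere_map_beyond: "j > d \<Longrightarrow> sphere_map e d f j = 0"
  by (simp add: sphere_map_def Let_def)

lemma min_coord_nonneg: "f \<in> std_simplex \<sigma> \<Longrightarrow> 0 \<le> min_coord \<sigma> f"
  using min_coord_attained[OF enum_finite enum_nonempty] by (metis (mono_tags, lifting) mem_Collect_eq std_simplex_def)

text \<open>If both squares vanished, all coordinates on \<open>\<sigma>\<close> would be equal and
  the least one would be 0, against coordinate sum 1.\<close>

lemma sphere_map_denominator_pos:
  assumes f: "f \<in> std_simplex \<sigma>"
  shows "0 < (\<Sum>j\<in>{1..d}. (f (e j) - f (e 0))\<^sup>2) + (min_coord \<sigma> f)\<^sup>2"
proof (rule ccontr)
  let ?A = "\<Sum>j\<in>{1..d}. (f (e j) - f (e 0))\<^sup>2"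
  have A: "0 \<le> ?A" by (simp add: sum_nonneg)
  assume "\<not> ?thesis"
  then have 0: "?A + (min_coord \<sigma> f)\<^sup>2 = 0" using A by (smt (verit) zero_le_power2)
  then have \<mu>: "min_coord \<sigma> f = 0" and "?A = 0"
    using A by (smt (verit) zero_le_power2 power2_eq_iff zero_eq_power2)+
  then have "\<forall>j\<in>{1..d}. (f (e j) - f (e 0))\<^sup>2 = 0"
    by (subst (asm) sum_nonneg_eq_0_iff) auto
  then have const: "f (e j) = f (e 0)" if "j \<le> d" for j
    using that by (cases "j = 0") auto
  obtain w where w: "w \<in> \<sigma>" "f w = 0" using min_coord_attained[OF enum_finite enum_nonempty] \<mu> by metis
  have "f w' = f (e 0)" if "w' \<in> \<sigma>" for w'
    using const that enum_image by (metis atMost_iff imageE)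
  then have "\<forall>w\<in>\<sigma>. f w = 0" using w by metis
  then have "sum f \<sigma> = 0" by simp
  then show False using f by (simp add: std_simplex_def)
qed

lemma continuous_on_sphere_map: "continuous_on (std_simplex \<sigma>) (sphere_map e d)"
proof (rule continuous_on_coordinatewise_then_product)
  fix j
  have c: "continuous_on (std_simplex \<sigma>) (\<lambda>f. f w)" for w
    by (auto intro: continuous_on_subset[OF continuous_on_product_coordinates])
  have m: "continuous_on (std_simplex \<sigma>) (min_coord \<sigma>)"
    by (intro continuous_on_min_coord enum_finite enum_nonempty)
  consider "j = 0" | "j \<noteq> 0" "j \<le> d" | "j > d" by linarith
  then show "continuous_on (std_simplex \<sigma>) (\<lambda>f. sphere_map e d f j)"
  proof cases
    case 1
    show ?thesis unfolding 1 sphere_map_0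
      by (intro continuous_intros c m) (use sphere_map_denominator_pos in force)
  next
    case 2
    show ?thesis unfolding sphere_map_pos[OF 2]
      by (intro continuous_intros c m) (use sphere_map_denominator_pos in force)
  qed (simp add: sphere_map_beyond)
qed

text \<open>Comes down to the identity \<open>(A - \<mu>\<^sup>2)\<^sup>2 + 4 * \<mu>\<^sup>2 * A =
  (A + \<mu>\<^sup>2)\<^sup>2\<close>.\<close>

lemma sphere_map_in_nsphere:
  assumes f: "f \<in> std_simplex \<sigma>"
  shows "sphere_map e d f \<in> topspace (nsphere d)"
proof -
  define A where "A = (\<Sum>j\<in>{1..d}. (f (e j) - f (e 0))\<^sup>2)"
  define \<mu> where "\<mu> = min_coord \<sigma> f"
  have pos: "0 < A + \<mu>\<^sup>2" using sphere_map_denominator_pos[OF f] by (simp add: A_def \<mu>_def)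
  have "sphere_map e d f j = 2 * \<mu> * (f (e j) - f (e 0)) / (A + \<mu>\<^sup>2)" if "j \<in> {1..d}" for j
    using that sphere_map_pos[of j f] by (simp add: A_def \<mu>_def)
  then have "(\<Sum>j\<in>{1..d}. (sphere_map e d f j)\<^sup>2) =
      (\<Sum>j\<in>{1..d}. (2 * \<mu> / (A + \<mu>\<^sup>2))\<^sup>2 * (f (e j) - f (e 0))\<^sup>2)"
    by (intro sum.cong) (auto simp: power_mult_distrib power_divide)
  also have "\<dots> = (2 * \<mu> / (A + \<mu>\<^sup>2))\<^sup>2 * A"
    by (simp add: A_def sum_distrib_left)
  finally have "(\<Sum>j\<le>d. (sphere_map e d f j)\<^sup>2) =
      ((A - \<mu>\<^sup>2) / (A + \<mu>\<^sup>2))\<^sup>2 + (2 * \<mu> / (A + \<mu>\<^sup>2))\<^sup>2 * A"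
    by (simp add: atMost_atLeast0 sum.atLeast_Suc_atMost sphere_map_0 A_def \<mu>_def)
  also have "\<dots> = ((A - \<mu>\<^sup>2)\<^sup>2 + (2 * \<mu>)\<^sup>2 * A) / (A + \<mu>\<^sup>2)\<^sup>2"
    by (simp add: power_divide add_divide_distrib)
  also have "(A - \<mu>\<^sup>2)\<^sup>2 + (2 * \<mu>)\<^sup>2 * A = (A + \<mu>\<^sup>2)\<^sup>2"
    by (simp add: power2_eq_square algebra_simps)
  finally show ?thesis
    using pos by (simp add: nsphere sphere_map_beyond)
qed

lemma sphere_map_eq_base_iff:
  assumes f: "f \<in> std_simplex \<sigma>"
  shows "sphere_map e d f = nsphere_base \<longleftrightarrow> min_coord \<sigma> f = 0"
proof
  have pos: "(\<Sum>j\<in>{1..d}. (f (e j) - f (e 0))\<^sup>2) + (min_coord \<sigma> f)\<^sup>2 \<noteq> 0"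
    using sphere_map_denominator_pos[OF f] by simp
  {
    assume "sphere_map e d f = nsphere_base"
    then have "sphere_map e d f 0 = 1" by (simp add: nsphere_base_def)
    then show "min_coord \<sigma> f = 0" using pos by (simp add: sphere_map_0)
  next
    assume "min_coord \<sigma> f = 0"
    then have "sphere_map e d f j = nsphere_base j" for j
      using pos sphere_map_beyond[of j f] sphere_map_pos[of j f]
      by (cases "j = 0"; cases "j \<le> d") (auto simp: sphere_map_0 nsphere_base_def)
    then show "sphere_map e d f = nsphere_base" by blast
  }
qed

text \<open>Stereographic projection of the image recovers the quotients
  \<open>(f (e j) - f (e 0)) / \<mu>\<close>. Hence two points with the same image are related by
  \<open>f = a + b * g\<close> on \<open>\<sigma>\<close>, where \<open>b\<close> is the quotient of
  their least coordinates. Comparing least coordinates gives \<open>a = 0\<close>, comparing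
  coordinate sums gives \<open>b = 1\<close>.\<close>

lemma sphere_map_inj:
  assumes f: "f \<in> std_simplex \<sigma>" and g: "g \<in> std_simplex \<sigma>"
    and eq: "sphere_map e d f = sphere_map e d g" and ne: "sphere_map e d f \<noteq> nsphere_base"
  shows "f = g"
proof -
  have ratio: "(h (e j) - h (e 0)) / min_coord \<sigma> h =
      sphere_map e d h j / (1 - sphere_map e d h 0)"
    if h: "h \<in> std_simplex \<sigma>" "min_coord \<sigma> h \<noteq> 0" and j: "j \<le> d" "j \<noteq> 0" for h j
  proof -
    define A where "A = (\<Sum>j\<in>{1..d}. (h (e j) - h (e 0))\<^sup>2)"
    define \<mu> where "\<mu> = min_coord \<sigma> h"
    have pos: "A + \<mu>\<^sup>2 \<noteq> 0"
      using sphere_map_denominator_pos[OF h(1)] by (simp add: A_def \<mu>_def)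
    have "1 - sphere_map e d h 0 = 2 * \<mu>\<^sup>2 / (A + \<mu>\<^sup>2)"
      unfolding sphere_map_0 A_def[symmetric] \<mu>_def[symmetric] using pos by (simp add: field_simps)
    moreover have "sphere_map e d h j = 2 * \<mu> * (h (e j) - h (e 0)) / (A + \<mu>\<^sup>2)"
      unfolding sphere_map_pos[OF j(2,1)] A_def \<mu>_def by simp
    ultimately show ?thesis
      using pos h(2) unfolding \<mu>_def[symmetric] by (simp add: power2_eq_square)
  qed
  have \<mu>f: "min_coord \<sigma> f > 0" and \<mu>g: "min_coord \<sigma> g > 0"
    using sphere_map_eq_base_iff f g eq ne min_coord_nonneg by (metis order_less_le)+
  define b where "b = min_coord \<sigma> f / min_coord \<sigma> g"
  define a where "a = f (e 0) - b * g (e 0)"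
  have b: "b > 0" using \<mu>f \<mu>g by (simp add: b_def)
  have "f (e j) = a + b * g (e j)" if "j \<le> d" for j
  proof (cases "j = 0")
    case False
    then have "(f (e j) - f (e 0)) / min_coord \<sigma> f = (g (e j) - g (e 0)) / min_coord \<sigma> g"
      using ratio[of f j] ratio[of g j] eq f g \<mu>f \<mu>g that by simp
    then have "f (e j) - f (e 0) = b * (g (e j) - g (e 0))"
      using \<mu>f \<mu>g by (simp add: b_def field_simps)
    then show ?thesis by (simp add: a_def algebra_simps)
  qed (simp add: a_def)
  then have fg: "f w = a + b * g w" if "w \<in> \<sigma>" for w
    using that enum_image by auto
  have "min_coord \<sigma> f = a + b * min_coord \<sigma> g"
    using min_coord_affine[OF enum_finite enum_nonempty _ fg] b by simp
  then have "a = 0" using \<mu>g by (simp add: b_def)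
  then have "sum f \<sigma> = b * sum g \<sigma>" using fg by (simp add: sum_distrib_left)
  then have "b = 1" using f g by (simp add: std_simplex_def)
  then have "f w = g w" for w
    using fg[of w] \<open>a = 0\<close> std_simplex_outside[OF f] std_simplex_outside[OF g]
    by (cases "w \<in> \<sigma>") auto
  then show ?thesis by blast
qed

lemma sphere_map_surj:
  assumes y: "y \<in> topspace (nsphere d)" and ne: "y \<noteq> nsphere_base"
  obtains f where "f \<in> std_simplex \<sigma>" "sphere_map e d f = y"
proof -
  have sq: "(\<Sum>j\<le>d. (y j)\<^sup>2) = 1" and beyond: "\<And>j. j > d \<Longrightarrow> y j = 0"
    using y by (auto simp: nsphere)
  then have sq': "(\<Sum>j\<in>{1..d}. (y j)\<^sup>2) = 1 - (y 0)\<^sup>2"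
    by (simp add: atMost_atLeast0 sum.atLeast_Suc_atMost)
  have "y 0 \<noteq> 1"
  proof
    assume "y 0 = 1"
    then have "\<forall>j\<in>{1..d}. (y j)\<^sup>2 = 0"
      using sq' by (subst sum_nonneg_eq_0_iff[symmetric]) auto
    then have "y j = nsphere_base j" for j
      using \<open>y 0 = 1\<close> beyond[of j] by (cases "j = 0"; cases "j \<le> d") (auto simp: nsphere_base_def)
    then show False using ne by blast
  qed
  moreover have "(y 0)\<^sup>2 \<le> 1" using sq' by (smt (verit) sum_nonneg zero_le_power2)
  ultimately have y0: "y 0 < 1" by (smt (verit) power2_le_imp_le one_power2)
  \<comment> \<open>\<open>u\<close> is the stereographic projection of \<open>y\<close>, extended
    by \<open>u 0 = 0\<close>. The entries \<open>1 + u j - M\<close> have minimum 1, so after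
    division by their sum \<open>Z\<close> the least coordinate is \<open>1 / Z\<close> and the
    quotients by it are again \<open>u j\<close>.\<close>
  define u where "u j = (if j = 0 then 0 else y j / (1 - y 0))" for j :: nat
  define M where "M = min_coord {..d} u"
  have inj: "inj_on e {..d}" using e by (simp add: bij_betw_def)
  define e' where "e' = the_inv_into {..d} e"
  have e': "e' (e j) = j" if "j \<le> d" for j
    using inj that by (simp add: e'_def the_inv_into_f_f)
  have uM: "M \<le> u j" if "j \<le> d" for j using that by (simp add: M_def min_coord_le)
  define Z where "Z = (\<Sum>j\<le>d. 1 + u j - M)"
  have Z: "Z > 0" unfolding Z_def using uM by (intro sum_pos) (auto simp: add_strict_increasing)
  define f where "f w = (if w \<in> \<sigma> then (1 + u (e' w) - M) / Z else 0)" for w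
  have fe: "f (e j) = (1 + u j - M) / Z" if "j \<le> d" for j
    using that e' enum_image by (auto simp: f_def)
  have sum: "sum h \<sigma> = (\<Sum>j\<le>d. h (e j))" for h :: "'a \<Rightarrow> real"
    using sum.reindex[OF inj] enum_image by (metis (no_types, lifting) comp_apply sum.cong)
  have "sum f \<sigma> = (\<Sum>j\<le>d. (1 + u j - M) / Z)" unfolding sum using fe by simp
  then have "sum f \<sigma> = 1" using Z by (simp add: sum_divide_distrib[symmetric] Z_def)
  moreover have "0 \<le> f w" for w
  proof (cases "w \<in> \<sigma>")
    case True
    then obtain j where "j \<le> d" "w = e j" using enum_image by auto
    then show ?thesis using uM[of j] Z fe by simp
  qed (simp add: f_def)
  ultimately have f: "f \<in> std_simplex \<sigma>"
    by (auto simp: std_simplex_def f_def split: if_splits)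
  have \<mu>: "min_coord \<sigma> f = 1 / Z"
  proof (rule antisym)
    obtain j where "j \<le> d" "u j = M"
      using min_coord_attained[of "{..d}" u] unfolding M_def by auto
    then show "min_coord \<sigma> f \<le> 1 / Z"
      using min_coord_le[OF enum_finite, of "e j" f] fe[of j] enum_image by auto
    obtain w where "w \<in> \<sigma>" "f w = min_coord \<sigma> f" using min_coord_attained[OF enum_finite enum_nonempty] .
    moreover obtain j where "j \<le> d" "w = e j" using enum_image calculation by auto
    ultimately show "1 / Z \<le> min_coord \<sigma> f"
      using fe[of j] uM[of j] Z by (metis divide_right_mono le_diff_eq add_left_mono order_less_imp_le add.commute)
  qed
  have diff: "f (e j) - f (e 0) = u j / Z" if "j \<le> d" for j
    using that fe[of j] fe[of 0] by (simp add: u_def diff_divide_distrib[symmetric])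
  have "(\<Sum>j\<in>{1..d}. (f (e j) - f (e 0))\<^sup>2) = (\<Sum>j\<in>{1..d}. (y j)\<^sup>2 / ((1 - y 0) * Z)\<^sup>2)"
    by (intro sum.cong) (auto simp: diff u_def power_divide power_mult_distrib)
  also have "\<dots> = (1 - (y 0)\<^sup>2) / ((1 - y 0) * Z)\<^sup>2"
    unfolding sq'[symmetric] sum_divide_distrib ..
  also have "1 - (y 0)\<^sup>2 = (1 + y 0) * (1 - y 0)"
    by (simp add: power2_eq_square algebra_simps)
  also have "(1 + y 0) * (1 - y 0) / ((1 - y 0) * Z)\<^sup>2 = (1 + y 0) / (1 - y 0) / Z\<^sup>2"
    using y0 by (simp add: power2_eq_square)
  finally have A: "(\<Sum>j\<in>{1..d}. (f (e j) - f (e 0))\<^sup>2) = (1 + y 0) / (1 - y 0) / Z\<^sup>2" .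
  have "(1 + y 0) / (1 - y 0) + 1 = 2 / (1 - y 0)" "(1 + y 0) / (1 - y 0) - 1 = 2 * y 0 / (1 - y 0)"
    using y0 by (simp_all add: divide_simps)
  then have den: "(1 + y 0) / (1 - y 0) / Z\<^sup>2 + (1 / Z)\<^sup>2 = 2 / (1 - y 0) / Z\<^sup>2"
    and num: "(1 + y 0) / (1 - y 0) / Z\<^sup>2 - (1 / Z)\<^sup>2 = 2 * y 0 / (1 - y 0) / Z\<^sup>2"
    unfolding power_divide power_one by (metis add_divide_distrib diff_divide_distrib)+
  have "sphere_map e d f j = y j" for j
  proof -
    consider "j = 0" | "j \<noteq> 0" "j \<le> d" | "j > d" by linarith
    then show ?thesis
    proof cases
      case 1
      then show ?thesis unfolding 1 sphere_map_0 A \<mu> den num using y0 Z by simp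
    next
      case 2
      show ?thesis unfolding sphere_map_pos[OF 2] A \<mu> den diff[OF 2(2)]
        using y0 Z 2 by (simp add: u_def power2_eq_square)
    qed (simp add: sphere_map_beyond beyond)
  qed
  then show ?thesis using that f by blast
qed

end

lemma closed_std_simplex:
  shows "closed (std_simplex \<sigma>)"
proof -
  have "std_simplex \<sigma> = (\<Inter>v. {f. 0 \<le> f v}) \<inter> (\<Inter>v\<in>-\<sigma>. {f. f v = 0}) \<inter> {f. sum f \<sigma> = 1}"
    by (auto simp: std_simplex_def)
  then show ?thesis
    by (auto intro!: closed_Int closed_INT closed_Collect_le closed_Collect_eq continuous_on_sum continuous_intros)
qed

text \<open>A closed subset of a cube, which is compact by Tychonoff's theorem.\<close>

lemma compact_std_simplex:
  assumes "finite \<sigma>"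
  shows "compact (std_simplex \<sigma>)"
proof -
  have "compactin (powertop_real UNIV) (\<Pi>\<^sub>E i\<in>UNIV. {0..1})"
    by (simp add: compactin_PiE)
  then have "compact (\<Pi>\<^sub>E i\<in>(UNIV :: 'a set). {0..1::real})"
    by (simp add: euclidean_product_topology)
  moreover have "std_simplex \<sigma> \<subseteq> (\<Pi>\<^sub>E i\<in>UNIV. {0..1})"
  proof
    fix f assume f: "f \<in> std_simplex \<sigma>"
    have "f v \<le> sum f \<sigma>" if "v \<in> \<sigma>" for v
      using f assms that by (intro member_le_sum) (auto simp: std_simplex_def)
    then have "f v \<le> 1" for v
      using std_simplex_outside[OF f] f by (cases "v \<in> \<sigma>") (auto simp: std_simplex_def)
    then show "f \<in> (\<Pi>\<^sub>E i\<in>UNIV. {0..1})" using f by (auto simp: std_simplex_def)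
  qed
  ultimately show ?thesis
    using closed_std_simplex by (metis compact_Int_closed inf.absorb_iff2)
qed

text \<open>Homothety with ratio \<open>l\<close> about the barycentre, whose coordinates are
  \<open>1 / (d + 1)\<close> when \<open>\<sigma>\<close> has \<open>d + 1\<close> vertices.\<close>

definition scale_simplex :: "nat \<Rightarrow> 'a set \<Rightarrow> real \<Rightarrow> ('a \<Rightarrow> real) \<Rightarrow> 'a \<Rightarrow> real" where
  "scale_simplex d \<sigma> l f = (\<lambda>w. if w \<in> \<sigma> then 1 / (real d + 1) + l * (f w - 1 / (real d + 1)) else 0)"

lemma scale_simplex_1: "f \<in> std_simplex \<sigma> \<Longrightarrow> scale_simplex d \<sigma> 1 f = f"
  by (auto simp: scale_simplex_def std_simplex_outside)

text \<open>In terms of the radial coordinate \<open>1 - (d + 1) * min_coord \<sigma> f\<close>, the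
  homothety is multiplication by \<open>l\<close>. It therefore stays in the simplex as long as the
  product is at most 1.\<close>

lemma min_coord_scale_simplex:
  assumes "finite \<sigma>" "\<sigma> \<noteq> {}" "0 \<le> l"
  shows "(real d + 1) * min_coord \<sigma> (scale_simplex d \<sigma> l f) = 1 - l * (1 - (real d + 1) * min_coord \<sigma> f)"
proof -
  have "min_coord \<sigma> (scale_simplex d \<sigma> l f) = (1 / (real d + 1) - l / (real d + 1)) + l * min_coord \<sigma> f"
    by (rule min_coord_affine) (use assms in \<open>auto simp: scale_simplex_def algebra_simps\<close>)
  then show ?thesis by (simp add: field_simps)
qed

lemma scale_simplex_in:
  assumes f: "f \<in> std_simplex \<sigma>" and card: "card \<sigma> = d + 1" and l: "0 \<le> l"
    and le: "l * (1 - (real d + 1) * min_coord \<sigma> f) \<le> 1"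
  shows "scale_simplex d \<sigma> l f \<in> std_simplex \<sigma>"
proof -
  have fin: "finite \<sigma>" and ne: "\<sigma> \<noteq> {}" using card by (auto intro: card_ge_0_finite)
  have "(real d + 1) * min_coord \<sigma> (scale_simplex d \<sigma> l f) \<ge> 0"
    using min_coord_scale_simplex[OF fin ne l, of d f] le by linarith
  then have "min_coord \<sigma> (scale_simplex d \<sigma> l f) \<ge> 0"
    by (simp add: zero_le_mult_iff)
  then have "0 \<le> scale_simplex d \<sigma> l f w" for w
    using min_coord_le[OF fin, of w "scale_simplex d \<sigma> l f"]
    by (cases "w \<in> \<sigma>") (simp, simp add: scale_simplex_def)
  moreover have "sum (scale_simplex d \<sigma> l f) \<sigma> = 1"
  proof -
    have "sum (scale_simplex d \<sigma> l f) \<sigma> = (\<Sum>w\<in>\<sigma>. 1 / (real d + 1)) + l * (sum f \<sigma> - (\<Sum>w\<in>\<sigma>. 1 / (real d + 1)))"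
      unfolding scale_simplex_def by (simp add: sum.distrib sum_distrib_left[symmetric] sum_subtractf)
    then show ?thesis using f card by (simp add: std_simplex_def field_simps)
  qed
  ultimately show ?thesis by (auto simp: std_simplex_def scale_simplex_def)
qed

lemma continuous_on_scale_simplex:
  "continuous_on S (\<lambda>p. scale_simplex d \<sigma> (a p) (b p))"
  if "continuous_on S a" "continuous_on S b" for a :: "'b::topological_space \<Rightarrow> real"
proof (rule continuous_on_coordinatewise_then_product)
  fix w
  show "continuous_on S (\<lambda>p. scale_simplex d \<sigma> (a p) (b p) w)"
    unfolding scale_simplex_def
    by (cases "w \<in> \<sigma>"; simp; intro continuous_intros that continuous_on_product_then_coordinatewise[OF that(2)])
qed

lemma min_coord_le_barycentre:
  assumes f: "f \<in> std_simplex \<sigma>" and card: "card \<sigma> = d + 1"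
  shows "(real d + 1) * min_coord \<sigma> f \<le> 1"
proof -
  have fin: "finite \<sigma>" using card by (auto intro: card_ge_0_finite)
  have "(\<Sum>w\<in>\<sigma>. min_coord \<sigma> f) \<le> sum f \<sigma>"
    by (rule sum_mono) (simp add: min_coord_le[OF fin])
  then show ?thesis using f card by (simp add: std_simplex_def algebra_simps)
qed

lemma min_coord_eq_0_iff:
  assumes f: "f \<in> std_simplex \<sigma>" and "finite \<sigma>" "\<sigma> \<noteq> {}"
  shows "min_coord \<sigma> f = 0 \<longleftrightarrow> {v. f v \<noteq> 0} \<noteq> \<sigma>"
proof
  obtain w where "w \<in> \<sigma>" "f w = min_coord \<sigma> f" using min_coord_attained[OF assms(2,3)] .
  then show "min_coord \<sigma> f = 0 \<Longrightarrow> {v. f v \<noteq> 0} \<noteq> \<sigma>" by auto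
  assume "{v. f v \<noteq> 0} \<noteq> \<sigma>"
  then obtain w where "w \<in> \<sigma>" "f w = 0" using f by (auto simp: std_simplex_def)
  then show "min_coord \<sigma> f = 0"
    using min_coord_eq_0[OF assms(2)] f by (auto simp: std_simplex_def)
qed

text \<open>A contractible complex \<open>L\<close> with \<open>d\<close>-cells attached along their
  boundaries. The empty set counts as contractible, hence the separate assumption \<open>ne\<close>:
  a point of \<open>L\<close> is needed to reach the base point of the wedge.\<close>

locale contractible_plus_cells =
  fixes K L :: "'a set set" and d :: nat
  assumes K: "abstract_simplicial_complex K" and finK: "finite K"
    and L: "abstract_simplicial_complex L" and LK: "L \<subseteq> K"
    and contr: "contractible (realization_points L)" and ne: "realization_points L \<noteq> {}"
    and cell_card: "\<And>\<sigma>. \<sigma> \<in> K - L \<Longrightarrow> card \<sigma> = d + 1"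
    and cell_boundary: "\<And>\<sigma> \<tau>. \<sigma> \<in> K - L \<Longrightarrow> \<tau> \<subset> \<sigma> \<Longrightarrow> \<tau> \<in> L"
begin

abbreviation "supp f \<equiv> {v. f v \<noteq> (0::real)}"

lemma cell_finite: "\<sigma> \<in> K - L \<Longrightarrow> finite \<sigma>"
  by (rule card_ge_0_finite) (simp add: cell_card)

lemma cell_ne: "\<sigma> \<in> K - L \<Longrightarrow> \<sigma> \<noteq> {}"
  using cell_card by fastforce

lemma supp_cell:
  assumes "\<sigma> \<in> K - L" "f \<in> std_simplex \<sigma>"
  shows "supp f = \<sigma> \<and> min_coord \<sigma> f \<noteq> 0 \<or> supp f \<in> L \<and> min_coord \<sigma> f = 0"
  using cell_boundary[OF assms(1), of "supp f"] min_coord_eq_0_iff[OF assms(2) cell_finite cell_ne] assms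
  by (auto simp: std_simplex_def)

lemma realization_L_iff: "f \<in> realization_points K \<Longrightarrow> f \<in> realization_points L \<longleftrightarrow> supp f \<in> L"
  by (auto simp: realization_points_def)

lemma supp_in_std_simplex: "f \<in> realization_points K \<Longrightarrow> f \<in> std_simplex (supp f)"
  by (simp add: realization_points_def std_simplex_def)

lemma simplex_subset: "\<sigma> \<in> K \<Longrightarrow> std_simplex \<sigma> \<subseteq> realization_points K"
  using K by (auto simp: realization_points_Union)

lemma realization_L_subset: "realization_points L \<subseteq> realization_points K"
  using LK by (auto simp: realization_points_def)

lemma realization_cover:
  "realization_points K = realization_points L \<union> (\<Union>\<sigma>\<in>K - L. std_simplex \<sigma>)"
  using K L LK by (auto simp: realization_points_Union)

lemma closed_realization_L: "closed (realization_points L)"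
  unfolding realization_points_Union[OF L]
  using finK LK by (intro closed_UN) (auto intro: finite_subset closed_std_simplex)

text \<open>On a cell, \<open>s \<sigma> f\<close> is the radial coordinate, from \<open>0\<close> at the barycentre to \<open>1\<close> on the boundary.
  At time \<open>t\<close> the part \<open>s \<le> 1 / (1 + t)\<close> is stretched over the whole cell, and the remaining collar
  follows the given homotopy \<open>h\<close> of the boundary.\<close>

lemma homotopy_extension:
  obtains H :: "real \<times> ('a \<Rightarrow> real) \<Rightarrow> 'a \<Rightarrow> real" and p where
    "continuous_on ({0..1} \<times> realization_points K) H"
    "H ` ({0..1} \<times> realization_points K) \<subseteq> realization_points K"
    "H ` ({0..1} \<times> realization_points L) \<subseteq> realization_points L"
    "\<And>f. f \<in> realization_points K \<Longrightarrow> H (0, f) = f"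
    "\<And>f. f \<in> realization_points L \<Longrightarrow> H (1, f) = p"
proof -
  let ?X = "realization_points K" and ?Y = "realization_points L"
  obtain p where "homotopic_with_canon (\<lambda>x. True) ?Y ?Y id (\<lambda>x. p)"
    using contr by (auto simp: contractible_def)
  then have "\<exists>h. continuous_on ({0..1::real} \<times> ?Y) h \<and> h \<in> {0..1} \<times> ?Y \<rightarrow> ?Y \<and>
      (\<forall>f. h (0, f) = f) \<and> (\<forall>f. h (1, f) = p)"
    by (simp add: homotopic_with_def)
  then obtain h where h: "continuous_on ({0..1::real} \<times> ?Y) h" "h ` ({0..1} \<times> ?Y) \<subseteq> ?Y"
      "\<And>f. h (0, f) = f" "\<And>f. h (1, f) = p"
    by (metis image_subset_iff_funcset)
  define s :: "'a set \<Rightarrow> ('a \<Rightarrow> real) \<Rightarrow> real" where "s \<sigma> f = 1 - (real d + 1) * min_coord \<sigma> f" for \<sigma> f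
  \<comment> \<open>The ratio \<open>1 / s \<sigma> f\<close> carries \<open>f\<close> radially to
    the boundary. Where the branches meet, \<open>s \<sigma> f * (1 + t) = 1\<close>, the ratios
    agree and \<open>h\<close> is taken at time 0, where it is the identity.\<close>
  define G where "G \<sigma> = (\<lambda>(t, f). if s \<sigma> f * (1 + t) \<le> 1 then scale_simplex d \<sigma> (1 + t) f
      else h (s \<sigma> f * (1 + t) - 1, scale_simplex d \<sigma> (1 / s \<sigma> f) f))" for \<sigma>
  define H where "H = (\<lambda>(t, f). if supp f \<in> L then h (t, f) else G (supp f) (t, f))"
  have s01: "0 \<le> s \<sigma> f" "s \<sigma> f \<le> 1" if \<sigma>: "\<sigma> \<in> K - L" and f: "f \<in> std_simplex \<sigma>" for \<sigma> f
  proof -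
    show "0 \<le> s \<sigma> f"
      using min_coord_le_barycentre[OF f cell_card[OF \<sigma>]] by (simp add: s_def)
    obtain w where "f w = min_coord \<sigma> f"
      using min_coord_attained[OF cell_finite[OF \<sigma>] cell_ne[OF \<sigma>]] by metis
    moreover have "0 \<le> f w" using f by (simp add: std_simplex_def)
    ultimately show "s \<sigma> f \<le> 1" by (simp add: s_def)
  qed
  have scale_Y: "scale_simplex d \<sigma> (1 / s \<sigma> f) f \<in> ?Y"
    if \<sigma>: "\<sigma> \<in> K - L" and f: "f \<in> std_simplex \<sigma>" and pos: "s \<sigma> f > 0" for \<sigma> f
  proof -
    have in\<sigma>: "scale_simplex d \<sigma> (1 / s \<sigma> f) f \<in> std_simplex \<sigma>"
      by (rule scale_simplex_in[OF f cell_card[OF \<sigma>]]) (use pos in \<open>auto simp: s_def\<close>)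
    have "(real d + 1) * min_coord \<sigma> (scale_simplex d \<sigma> (1 / s \<sigma> f) f) = 0"
      using min_coord_scale_simplex[OF cell_finite[OF \<sigma>] cell_ne[OF \<sigma>], of "1 / s \<sigma> f" d f] pos
      by (simp add: s_def)
    then have "supp (scale_simplex d \<sigma> (1 / s \<sigma> f) f) \<in> L"
      using supp_cell[OF \<sigma> in\<sigma>] by auto
    then show ?thesis
      using in\<sigma> simplex_subset \<sigma> realization_L_iff by blast
  qed
  have HL: "H (t, f) = h (t, f)" if "f \<in> ?Y" for t f
    using that by (simp add: H_def realization_points_def)
  \<comment> \<open>On the boundary \<open>s \<sigma> f = 1\<close>, so \<open>G\<close> reduces to
    \<open>h\<close>. The definitions thus agree on overlaps, and continuity of \<open>H\<close> can
    be pasted over finitely many closed pieces.\<close>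
  have HG: "H (t, f) = G \<sigma> (t, f)" if \<sigma>: "\<sigma> \<in> K - L" and f: "f \<in> std_simplex \<sigma>" and t: "t \<in> {0..1}" for t f \<sigma>
  proof -
    consider "supp f = \<sigma>" | "supp f \<in> L" "min_coord \<sigma> f = 0" using supp_cell[OF \<sigma> f] by blast
    then show ?thesis
    proof cases
      case 1
      then show ?thesis using \<sigma> by (simp add: H_def)
    next
      case 2
      then have "s \<sigma> f = 1" by (simp add: s_def)
      then show ?thesis
        using 2 t h(3) scale_simplex_1[OF f] by (auto simp: H_def G_def)
    qed
  qed
  have GX: "G \<sigma> (t, f) \<in> ?X" if \<sigma>: "\<sigma> \<in> K - L" and f: "f \<in> std_simplex \<sigma>" and t: "t \<in> {0..1}" for t f \<sigma>
  proof (cases "s \<sigma> f * (1 + t) \<le> 1")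
    case True
    then have "scale_simplex d \<sigma> (1 + t) f \<in> std_simplex \<sigma>"
      by (intro scale_simplex_in[OF f cell_card[OF \<sigma>]]) (use t in \<open>auto simp: s_def mult.commute\<close>)
    then show ?thesis using True \<sigma> simplex_subset by (auto simp: G_def)
  next
    case False
    then have pos: "s \<sigma> f > 0" using s01[OF \<sigma> f] t by (cases "s \<sigma> f = 0") auto
    have "s \<sigma> f * (1 + t) \<le> 1 * 2"
      by (rule mult_mono) (use s01[OF \<sigma> f] t in auto)
    then have "s \<sigma> f * (1 + t) - 1 \<in> {0..1}" using False by auto
    then have "h (s \<sigma> f * (1 + t) - 1, scale_simplex d \<sigma> (1 / s \<sigma> f) f) \<in> ?Y"
      using h(2) scale_Y[OF \<sigma> f pos] by blast
    then show ?thesis using False realization_L_subset by (auto simp: G_def)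
  qed
  have contG: "continuous_on ({0..1} \<times> std_simplex \<sigma>) (G \<sigma>)" if \<sigma>: "\<sigma> \<in> K - L" for \<sigma>
  proof -
    let ?S = "{0..1} \<times> std_simplex \<sigma>"
    have cs: "continuous_on S (\<lambda>p. s \<sigma> (snd p))" for S :: "(real \<times> ('a \<Rightarrow> real)) set"
      unfolding s_def
      by (intro continuous_intros continuous_on_compose2[OF continuous_on_min_coord[OF cell_finite[OF \<sigma>] cell_ne[OF \<sigma>], where S = UNIV], where f = snd]) auto
    have pos: "s \<sigma> (snd p) > 0" if "p \<in> {p \<in> ?S. 1 \<le> s \<sigma> (snd p) * (1 + fst p)}" for p
      using that s01[OF \<sigma>, of "snd p"] by (cases "s \<sigma> (snd p) = 0") auto
    have "continuous_on ?S (\<lambda>p. if s \<sigma> (snd p) * (1 + fst p) \<le> 1 then scale_simplex d \<sigma> (1 + fst p) (snd p)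
      else h (s \<sigma> (snd p) * (1 + fst p) - 1, scale_simplex d \<sigma> (1 / s \<sigma> (snd p)) (snd p)))"
    proof (rule continuous_on_cases_le)
      show "continuous_on {p \<in> ?S. s \<sigma> (snd p) * (1 + fst p) \<le> 1} (\<lambda>p. scale_simplex d \<sigma> (1 + fst p) (snd p))"
        by (intro continuous_on_scale_simplex continuous_intros)
      show "continuous_on {p \<in> ?S. 1 \<le> s \<sigma> (snd p) * (1 + fst p)}
         (\<lambda>p. h (s \<sigma> (snd p) * (1 + fst p) - 1, scale_simplex d \<sigma> (1 / s \<sigma> (snd p)) (snd p)))"
      proof (rule continuous_on_compose2[OF h(1)])
        show "continuous_on {p \<in> ?S. 1 \<le> s \<sigma> (snd p) * (1 + fst p)}
         (\<lambda>p. (s \<sigma> (snd p) * (1 + fst p) - 1, scale_simplex d \<sigma> (1 / s \<sigma> (snd p)) (snd p)))"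
          by (intro continuous_on_scale_simplex continuous_intros cs) (use pos in force)
        show "(\<lambda>p. (s \<sigma> (snd p) * (1 + fst p) - 1, scale_simplex d \<sigma> (1 / s \<sigma> (snd p)) (snd p))) `
          {p \<in> ?S. 1 \<le> s \<sigma> (snd p) * (1 + fst p)} \<subseteq> {0..1} \<times> ?Y"
        proof (intro image_subsetI)
          fix p assume p: "p \<in> {p \<in> ?S. 1 \<le> s \<sigma> (snd p) * (1 + fst p)}"
          have "s \<sigma> (snd p) * (1 + fst p) \<le> 1 * 2"
            by (rule mult_mono) (use p s01[OF \<sigma>, of "snd p"] in auto)
          then show "(s \<sigma> (snd p) * (1 + fst p) - 1, scale_simplex d \<sigma> (1 / s \<sigma> (snd p)) (snd p)) \<in> {0..1} \<times> ?Y"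
            using p scale_Y[OF \<sigma> _ pos[OF p]] by auto
        qed
      qed
      show "continuous_on ?S (\<lambda>p. s \<sigma> (snd p) * (1 + fst p))"
        by (intro continuous_intros cs)
      fix p assume p: "p \<in> ?S" and 1: "s \<sigma> (snd p) * (1 + fst p) = 1"
      then have "1 / s \<sigma> (snd p) = 1 + fst p" by (metis mult_cancel_left1 mult_zero_left nonzero_eq_divide_eq mult.commute zero_neq_one)
      then show "scale_simplex d \<sigma> (1 + fst p) (snd p) =
          h (s \<sigma> (snd p) * (1 + fst p) - 1, scale_simplex d \<sigma> (1 / s \<sigma> (snd p)) (snd p))"
        using 1 h(3) by simp
    qed
    then show ?thesis by (simp add: G_def case_prod_unfold)
  qed
  have "continuous_on ({0..1} \<times> ?X) H"
  proof -
    have "{0..1} \<times> ?X = {0..1} \<times> ?Y \<union> (\<Union>\<sigma>\<in>K - L. {0..1::real} \<times> std_simplex \<sigma>)"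
      using realization_cover by auto
    moreover have "continuous_on ({0..1} \<times> ?Y) H"
      using h(1) HL by (subst continuous_on_cong[OF refl, of _ _ h]) auto
    moreover have "continuous_on (\<Union>\<sigma>\<in>K - L. {0..1} \<times> std_simplex \<sigma>) H"
    proof (rule continuous_on_closed_Union)
      show "continuous_on ({0..1} \<times> std_simplex \<sigma>) H" if "\<sigma> \<in> K - L" for \<sigma>
        using contG[OF that] HG[OF that] by (subst continuous_on_cong[OF refl, of _ _ "G \<sigma>"]) auto
    qed (use finK in \<open>auto intro: closed_Times closed_std_simplex\<close>)
    moreover have "closed (\<Union>\<sigma>\<in>K - L. {0..1::real} \<times> std_simplex \<sigma>)"
      using finK by (intro closed_UN) (auto intro: closed_Times closed_std_simplex)
    ultimately show ?thesis
      using closed_realization_L by (auto intro!: continuous_on_closed_Un closed_Times)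
  qed
  moreover have "H ` ({0..1} \<times> ?Y) \<subseteq> ?Y" using h(2) HL by force
  moreover have "H (t, f) \<in> ?X" if f: "f \<in> ?X" and t: "t \<in> {0..1}" for t f
  proof -
    consider "f \<in> ?Y" | \<sigma> where "\<sigma> \<in> K - L" "f \<in> std_simplex \<sigma>"
      using f realization_cover by auto
    then show ?thesis
    proof cases
      case 1
      then show ?thesis using HL h(2) t realization_L_subset by force
    next
      case 2
      then show ?thesis using HG[OF 2 t] GX[OF 2 t] by simp
    qed
  qed
  moreover have "H (0, f) = f" if f: "f \<in> ?X" for f
  proof -
    consider "f \<in> ?Y" | \<sigma> where "\<sigma> \<in> K - L" "f \<in> std_simplex \<sigma>"
      using f realization_cover by auto
    then show ?thesis
    proof cases
      case 1
      then show ?thesis using HL h(3) by simp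
    next
      case 2
      then show ?thesis
        using HG[OF 2, of 0] s01[OF 2] scale_simplex_1[OF 2(2)] by (simp add: G_def)
    qed
  qed
  moreover have "H (1, f) = p" if "f \<in> ?Y" for f using HL h(4) that by simp
  ultimately show ?thesis using that[of H p] by (auto simp: image_subset_iff)
qed


text \<open>The map \<open>q\<close> sends \<open>L\<close> to the base point and each cell to its
  own sphere. Simplices are compact and spheres are Hausdorff, so \<open>q\<close> is closed and
  hence a quotient map, and its only fibre with more than one point can be \<open>L\<close>. The
  extended contraction keeps \<open>L\<close> inside itself and ends in a single point there, as
  \<open>quotient_homotopy_equivalence\<close> requires.\<close>

lemma homotopy_equivalent_wedge:
  "geometric_realization K homotopy_equivalent_space
   wedge_sum (\<lambda>_. nsphere d) (\<lambda>_. nsphere_base) {..<card (K - L)}"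
proof -
  let ?X = "realization_points K" and ?Y = "realization_points L"
  define N where "N = card (K - L)"
  let ?W = "wedge_sum (\<lambda>_::nat. nsphere d) (\<lambda>_. nsphere_base) {..<N}"
  let ?incl = "wedge_inclusion (\<lambda>_::nat. nsphere_base)"
  have "\<exists>c. bij_betw c {..<N} (K - L)"
    using ex_bij_betw_nat_finite[of "K - L"] finK by (simp add: N_def lessThan_atLeast0)
  then obtain c where c: "bij_betw c {..<N} (K - L)" by blast
  then have cC: "c i \<in> K - L" if "i < N" for i using that by (auto simp: bij_betw_def)
  have "\<exists>e. bij_betw e {..d} \<sigma>" if "\<sigma> \<in> K - L" for \<sigma>
    using ex_bij_betw_nat_finite[OF cell_finite[OF that]] cell_card[OF that]
    by (simp add: atLeast0_lessThan_Suc lessThan_Suc_atMost atLeast0LessThan)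
  then have "\<forall>i. \<exists>e. i < N \<longrightarrow> bij_betw e {..d} (c i)" using cC by blast
  then have "\<exists>e. \<forall>i. i < N \<longrightarrow> bij_betw (e i) {..d} (c i)" by (rule choice)
  then obtain e where e: "\<And>i. i < N \<Longrightarrow> bij_betw (e i) {..d} (c i)" by blast
  define ix where "ix = the_inv_into {..<N} c"
  have ix: "ix (c i) = i" if "i < N" for i
    using c that by (simp add: ix_def bij_betw_def the_inv_into_f_f)
  have ix': "ix \<sigma> < N" "c (ix \<sigma>) = \<sigma>" if \<sigma>: "\<sigma> \<in> K - L" for \<sigma>
  proof -
    obtain i where "i < N" "\<sigma> = c i"
      using c \<sigma> by (metis bij_betw_imp_surj_on imageE lessThan_iff)
    then show "ix \<sigma> < N" "c (ix \<sigma>) = \<sigma>" using ix by auto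
  qed
  define S where "S i = sphere_map (e i) d" for i
  define q where "q f = (if supp f \<in> L then None else ?incl (ix (supp f)) (S (ix (supp f)) f))" for f
  note S_base = sphere_map_eq_base_iff[OF e, folded S_def]
  note S_inj = sphere_map_inj[OF e, folded S_def]
  note S_in = sphere_map_in_nsphere[OF e, folded S_def]
  note S_cont = continuous_on_sphere_map[OF e, folded S_def]
  \<comment> \<open>The formula holds on the whole closed cell: its boundary lies in
    \<open>L\<close> and is sent by \<open>S i\<close> to \<open>nsphere_base\<close>, which the
    inclusion turns into \<open>None\<close>.\<close>
  have q_simplex: "q f = ?incl i (S i f)" if i: "i < N" and f: "f \<in> std_simplex (c i)" for i f
    using supp_cell[OF cC[OF i] f] ix[OF i] S_base[OF i f] cC[OF i]
    by (auto simp: q_def wedge_inclusion_def)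
  have cell_X: "f \<in> ?X" if "i < N" "f \<in> std_simplex (c i)" for i f
    using that simplex_subset cC[OF that(1)] by blast
  have q_L: "q f = None" if "f \<in> ?Y" for f
    using that by (simp add: q_def realization_points_def)
  have in_cell: "supp f \<in> K - L" "f \<in> std_simplex (c (ix (supp f)))" "ix (supp f) < N"
    "S (ix (supp f)) f \<noteq> nsphere_base" "q f = Some (ix (supp f), S (ix (supp f)) f)"
    if f: "f \<in> ?X" "supp f \<notin> L" for f
  proof -
    show 1: "supp f \<in> K - L" using f by (simp add: realization_points_def)
    show 2: "f \<in> std_simplex (c (ix (supp f)))" "ix (supp f) < N"
      using supp_in_std_simplex[OF f(1)] ix'[OF 1] by simp_all
    show 3: "S (ix (supp f)) f \<noteq> nsphere_base"
      using S_base[OF 2(2,1)] supp_cell[OF 1 supp_in_std_simplex[OF f(1)]] ix'[OF 1] 1 by auto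
    then show "q f = Some (ix (supp f), S (ix (supp f)) f)"
      using f by (simp add: q_def wedge_inclusion_def)
  qed
  have q_None: "q f = None \<longleftrightarrow> f \<in> ?Y" if "f \<in> ?X" for f
    using in_cell[OF that] q_L that realization_L_iff by (metis option.distinct(1))
  have q_inj: "f = g" if fg: "f \<in> ?X" "g \<in> ?X" "q f = q g" "f \<notin> ?Y" for f g
  proof -
    have f: "supp f \<notin> L" and g: "supp g \<notin> L"
      using fg q_None realization_L_iff by metis+
    have *: "ix (supp f) = ix (supp g)" "S (ix (supp f)) f = S (ix (supp g)) g"
      using fg(3) in_cell(5)[OF fg(1) f] in_cell(5)[OF fg(2) g] by auto
    then show ?thesis
      using S_inj[OF in_cell(3,2)[OF fg(1) f], of g] in_cell(2,4)[OF fg(2) g] by auto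
  qed
  have q_fibre: "f = g \<or> f \<in> ?Y \<and> g \<in> ?Y" if fg: "f \<in> ?X" "g \<in> ?X" "q f = q g" for f g
  proof (cases "f \<in> ?Y")
    case True
    then have "q g = None" using q_L fg(3) by metis
    then show ?thesis using True q_None fg(2) by blast
  next
    case False
    then show ?thesis using q_inj fg by blast
  qed
  have closedin_W: "closedin ?W T \<longleftrightarrow> T \<subseteq> topspace ?W \<and>
      (\<forall>i<N. closedin (nsphere d) {x \<in> topspace (nsphere d). ?incl i x \<in> T})" for T
  proof -
    have "{x \<in> topspace (nsphere d). ?incl i x \<in> topspace ?W - T} =
        topspace (nsphere d) - {x \<in> topspace (nsphere d). ?incl i x \<in> T}" if "i < N" for i
      using that by (auto simp: topspace_wedge_sum)
    then show ?thesis
      unfolding closedin_def[of ?W] openin_wedge_sum topspace_wedge_sum[symmetric]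
      by (auto simp: closedin_def[of "nsphere d"])
  qed
  have nsphere_top: "nsphere d = top_of_set (topspace (nsphere d))"
    by (simp add: nsphere euclidean_product_topology)
  have nsphere_Hausdorff: "Hausdorff_space (nsphere d)"
    unfolding nsphere by (intro Hausdorff_space_subtopology) (simp add: Hausdorff_space_product_topology)
  have S_closed: "closedin (nsphere d) (S i ` (A \<inter> std_simplex (c i)))" if "i < N" "closed A" for i A
  proof -
    have "compact (A \<inter> std_simplex (c i))"
      using that closed_Int_compact compact_std_simplex[OF cell_finite[OF cC]] by blast
    then have "compact (S i ` (A \<inter> std_simplex (c i)))"
      by (rule compact_continuous_image[OF continuous_on_subset[OF S_cont[OF that(1)]], rotated]) auto
    then have "compactin (nsphere d) (S i ` (A \<inter> std_simplex (c i)))"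
      by (subst nsphere_top) (use S_in[OF that(1)] in \<open>auto simp: compactin_subtopology\<close>)
    then show ?thesis by (rule compactin_imp_closedin[OF nsphere_Hausdorff])
  qed
  have sphere_base: "closedin (nsphere d) {nsphere_base}"
    using nsphere_Hausdorff nsphere_base_in_nsphere by (simp add: closedin_Hausdorff_sing_eq)
  have top_W: "w \<in> topspace ?W \<longleftrightarrow> w = None \<or> (\<exists>i<N. \<exists>x\<in>topspace (nsphere d). w = ?incl i x)" for w
    by (auto simp: topspace_wedge_sum)
  have q_in: "q f \<in> topspace ?W" if f: "f \<in> ?X" for f
  proof (cases "supp f \<in> L")
    case False
    then have "q f = ?incl (ix (supp f)) (S (ix (supp f)) f)" by (simp add: q_def)
    then show ?thesis
      using in_cell(3)[OF f False] S_in[OF in_cell(3,2)[OF f False]] unfolding top_W by blast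
  qed (simp add: q_def top_W)
  have cont_q: "continuous_map (top_of_set ?X) ?W q"
    unfolding continuous_map_closedin
  proof (intro conjI allI impI)
    show "q \<in> topspace (top_of_set ?X) \<rightarrow> topspace ?W"
      using q_in by auto
    fix T assume T: "closedin ?W T"
    \<comment> \<open>The preimage is split into finitely many pieces, one in \<open>L\<close> and
      one in each closed cell, so that closedness can be tested on each piece.\<close>
    have eq: "{f \<in> ?X. q f \<in> T} = (if None \<in> T then ?Y else {}) \<union>
        (\<Union>i<N. {f \<in> std_simplex (c i). ?incl i (S i f) \<in> T})" (is "?A = ?B")
    proof (intro equalityI subsetI)
      fix f assume f: "f \<in> ?A"
      then show "f \<in> ?B"
        using in_cell[of f] q_simplex[of "ix (supp f)" f] realization_L_iff[of f] q_L[of f]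
        by (cases "supp f \<in> L") auto
    next
      fix f assume "f \<in> ?B"
      then consider "None \<in> T" "f \<in> ?Y" | i where "i < N" "f \<in> std_simplex (c i)" "?incl i (S i f) \<in> T"
        by (auto split: if_splits)
      then show "f \<in> ?A"
        using q_L realization_L_subset q_simplex cell_X by cases auto
    qed
    have "closed {f \<in> std_simplex (c i). ?incl i (S i f) \<in> T}" if i: "i < N" for i
    proof -
      have "closedin (top_of_set (topspace (nsphere d))) {x \<in> topspace (nsphere d). ?incl i x \<in> T}"
        using T i closedin_W[of T] by (simp flip: nsphere_top)
      then obtain U where U: "closed U" "{x \<in> topspace (nsphere d). ?incl i x \<in> T} = topspace (nsphere d) \<inter> U"
        unfolding closedin_closed by blast
      have "{f \<in> std_simplex (c i). ?incl i (S i f) \<in> T} = std_simplex (c i) \<inter> S i -` U"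
        using U(2) S_in[OF i] by blast
      then show ?thesis
        using continuous_closed_preimage[OF S_cont[OF i] closed_std_simplex U(1)] by simp
    qed
    then have "closed ?A"
      unfolding eq using closed_realization_L by (intro closed_Un closed_UN) auto
    then show "closedin (top_of_set ?X) {f \<in> topspace (top_of_set ?X). q f \<in> T}"
      by (auto simp: closed_subset)
  qed
  have "closed_map (top_of_set ?X) ?W q"
    unfolding closed_map_def
  proof (intro allI impI)
    fix A assume "closedin (top_of_set ?X) A"
    then obtain A' where "closed A'" "A = ?X \<inter> A'" by (auto simp: closedin_closed)
    then have A'_simplex: "A \<inter> std_simplex (c i) = A' \<inter> std_simplex (c i)" if "i < N" for i
      using cell_X that by auto
    have "closedin (nsphere d) {x \<in> topspace (nsphere d). ?incl i x \<in> q ` A}" if i: "i < N" for i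
    proof -
      have eq: "{x \<in> topspace (nsphere d). ?incl i x \<in> q ` A} =
          S i ` (A' \<inter> std_simplex (c i)) \<union> (if None \<in> q ` A then {nsphere_base} else {})" (is "?P = ?Q")
      proof (intro equalityI subsetI)
        fix x assume x: "x \<in> ?P"
        show "x \<in> ?Q"
        proof (cases "x = nsphere_base")
          case True
          then show ?thesis using x by (simp add: wedge_inclusion_def)
        next
          case False
          then obtain f where f: "f \<in> A" "q f = Some (i, x)"
            using x by (auto simp: wedge_inclusion_def)
          then have "supp f \<notin> L" by (auto simp: q_def)
          then show ?thesis
            using in_cell[of f] f \<open>A = ?X \<inter> A'\<close> by auto
        qed
      next
        fix x assume x: "x \<in> ?Q"
        show "x \<in> ?P"
        proof (cases "x \<in> S i ` (A' \<inter> std_simplex (c i))")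
          case True
          then obtain f where f: "f \<in> A" "f \<in> std_simplex (c i)" "x = S i f"
            using A'_simplex[OF i] by blast
          then have "?incl i x = q f" using q_simplex[OF i] by simp
          then show ?thesis using f S_in[OF i] by auto
        next
          case False
          then have "x = nsphere_base" "None \<in> q ` A" using x by (auto split: if_splits)
          then show ?thesis using nsphere_base_in_nsphere by (simp add: wedge_inclusion_def)
        qed
      qed
      show ?thesis
        unfolding eq using S_closed[OF i \<open>closed A'\<close>] sphere_base by (intro closedin_Un) auto
    qed
    moreover have "q ` A \<subseteq> topspace ?W" using \<open>A = ?X \<inter> A'\<close> q_in by auto
    ultimately show "closedin ?W (q ` A)" unfolding closedin_W by blast
  qed
  moreover have "q ` topspace (top_of_set ?X) = topspace ?W"
  proof
    show "topspace ?W \<subseteq> q ` topspace (top_of_set ?X)"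
    proof
      fix w assume w: "w \<in> topspace ?W"
      show "w \<in> q ` topspace (top_of_set ?X)"
      proof (cases w)
        case None
        then show ?thesis using ne q_L realization_L_subset by (metis ex_in_conv image_eqI subsetD topspace_euclidean_subtopology)
      next
        case (Some p)
        then obtain i x where i: "i < N" "x \<in> topspace (nsphere d)" "w = Some (i, x)" "x \<noteq> nsphere_base"
          using w Some by (auto simp: top_W wedge_inclusion_def split: if_splits)
        obtain f where f: "f \<in> std_simplex (c i)" "S i f = x"
          using sphere_map_surj[OF e[OF i(1)] i(2,4)] unfolding S_def by blast
        then have "q f = w" using q_simplex[OF i(1)] i by (simp add: wedge_inclusion_def)
        then show ?thesis using f cell_X[OF i(1)] by auto
      qed
    qed
  qed (use q_in in auto)
  ultimately have quot: "quotient_map (top_of_set ?X) ?W q"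
    using cont_q by (intro continuous_closed_imp_quotient_map)
  obtain H p where H: "continuous_on ({0..1::real} \<times> ?X) H" "H ` ({0..1} \<times> ?X) \<subseteq> ?X"
    "H ` ({0..1} \<times> ?Y) \<subseteq> ?Y" and H0: "\<And>f. f \<in> ?X \<Longrightarrow> H (0, f) = f" and H1: "\<And>f. f \<in> ?Y \<Longrightarrow> H (1, f) = p"
    by (rule homotopy_extension) (rule that)
  have "top_of_set ?X homotopy_equivalent_space ?W"
  proof (rule quotient_homotopy_equivalence[OF quot])
    show "continuous_map (prod_topology (top_of_set {0..1}) (top_of_set ?X)) (top_of_set ?X) H"
      using H(1,2) by auto
    show "H (0, f) = f" if "f \<in> topspace (top_of_set ?X)" for f using that H0 by simp
    fix f g assume fg: "f \<in> topspace (top_of_set ?X)" "g \<in> topspace (top_of_set ?X)" "q f = q g"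
    then consider "f = g" | "f \<in> ?Y" "g \<in> ?Y"
      using q_fibre[of f g] unfolding topspace_euclidean_subtopology by blast
    note fibre = this
    show "H (1, f) = H (1, g)" by (rule fibre) (simp_all add: H1)
    show "q (H (t, f)) = q (H (t, g))" if t: "t \<in> {0..1}" for t
    proof (rule fibre)
      assume "f \<in> ?Y" "g \<in> ?Y"
      then have "H (t, f) \<in> ?Y" "H (t, g) \<in> ?Y" using H(3) t by auto
      then show ?thesis using q_L by simp
    qed simp
  qed
  then show ?thesis by (simp add: geometric_realization_eq N_def)
qed

end

section \<open>Acyclic matchings\<close>

definition toggle :: "'a \<Rightarrow> 'a set \<Rightarrow> 'a set" where
  "toggle x A = (if x \<in> A then A - {x} else insert x A)"

text \<open>An acyclic matching on \<open>K\<close> with critical faces \<open>C\<close>: acyclicity is witnessed by a monotone rank,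
  all faces of the same rank being matched by adding or removing the same vertex.\<close>

definition ranked_matching ::
    "'a set set \<Rightarrow> 'a set set \<Rightarrow> ('a set \<Rightarrow> 'b::linorder) \<Rightarrow> ('a set \<Rightarrow> 'a) \<Rightarrow> bool" where
  "ranked_matching K C r p \<longleftrightarrow> C \<subseteq> K \<and>
     (\<forall>\<sigma>\<in>K - C. toggle (p \<sigma>) \<sigma> \<in> K - C \<and> r (toggle (p \<sigma>) \<sigma>) = r \<sigma>) \<and>
     (\<forall>\<sigma>\<in>K - C. \<forall>\<tau>\<in>K - C. (\<sigma> \<subseteq> \<tau> \<longrightarrow> r \<sigma> \<le> r \<tau>) \<and> (r \<sigma> = r \<tau> \<longrightarrow> p \<sigma> = p \<tau>))"

lemma toggle_toggle [simp]: "toggle x (toggle x A) = A"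
  by (auto simp: toggle_def)

lemma ranked_matching_subset: "ranked_matching K C r p \<Longrightarrow> C \<subseteq> K"
  unfolding ranked_matching_def by (elim conjE)

lemma ranked_matching_mono:
  assumes "ranked_matching K C r p" "\<sigma> \<in> K - C" "\<tau> \<in> K - C"
  shows "\<sigma> \<subseteq> \<tau> \<Longrightarrow> r \<sigma> \<le> r \<tau>" and "r \<sigma> = r \<tau> \<Longrightarrow> p \<sigma> = p \<tau>"
proof -
  have "(\<sigma> \<subseteq> \<tau> \<longrightarrow> r \<sigma> \<le> r \<tau>) \<and> (r \<sigma> = r \<tau> \<longrightarrow> p \<sigma> = p \<tau>)"
    using assms(1)[unfolded ranked_matching_def] assms(2,3) by blast
  then show "\<sigma> \<subseteq> \<tau> \<Longrightarrow> r \<sigma> \<le> r \<tau>" "r \<sigma> = r \<tau> \<Longrightarrow> p \<sigma> = p \<tau>" by simp_all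
qed

lemma ranked_matching_toggle:
  assumes "ranked_matching K C r p" "\<sigma> \<in> K - C"
  shows "toggle (p \<sigma>) \<sigma> \<in> K - C" and "r (toggle (p \<sigma>) \<sigma>) = r \<sigma>" and "p (toggle (p \<sigma>) \<sigma>) = p \<sigma>"
proof -
  have *: "toggle (p \<sigma>) \<sigma> \<in> K - C \<and> r (toggle (p \<sigma>) \<sigma>) = r \<sigma>"
    using assms(1)[unfolded ranked_matching_def] assms(2) by blast
  then show "toggle (p \<sigma>) \<sigma> \<in> K - C" "r (toggle (p \<sigma>) \<sigma>) = r \<sigma>" by simp_all
  show "p (toggle (p \<sigma>) \<sigma>) = p \<sigma>"
    by (rule ranked_matching_mono(2)[OF assms(1) _ assms(2)]) (use * in simp_all)
qed

text \<open>Partners have equal rank, hence the same pivot, and toggling is an involution. So a face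
  whose partner belongs to the pair belongs to the pair itself.\<close>

lemma ranked_matching_remove_pair:
  assumes M: "ranked_matching K C r p" and \<tau>: "\<tau> \<in> K - C"
  shows "ranked_matching (K - {toggle (p \<tau>) \<tau>, \<tau>}) C r p"
proof -
  have "toggle (p \<rho>) \<rho> \<notin> {toggle (p \<tau>) \<tau>, \<tau>}"
    if \<rho>: "\<rho> \<in> K - C" "\<rho> \<notin> {toggle (p \<tau>) \<tau>, \<tau>}" for \<rho>
  proof
    assume "toggle (p \<rho>) \<rho> \<in> {toggle (p \<tau>) \<tau>, \<tau>}"
    moreover have "r (toggle (p \<rho>) \<rho>) = r \<rho>"
      using ranked_matching_toggle[OF M \<rho>(1)] by blast
    ultimately have "r \<rho> = r \<tau>"
      using ranked_matching_toggle[OF M \<tau>] by auto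
    then have "p \<rho> = p \<tau>" using ranked_matching_mono[OF M \<rho>(1) \<tau>] by blast
    then have "toggle (p \<tau>) (toggle (p \<rho>) \<rho>) = \<rho>" by simp
    then have "\<rho> \<in> toggle (p \<tau>) ` {toggle (p \<tau>) \<tau>, \<tau>}"
      using \<open>toggle (p \<rho>) \<rho> \<in> _\<close> by (metis image_eqI)
    then show False using \<rho>(2) by auto
  qed
  then have "toggle (p \<rho>) \<rho> \<in> K - {toggle (p \<tau>) \<tau>, \<tau>} - C"
    if "\<rho> \<in> K - {toggle (p \<tau>) \<tau>, \<tau>} - C" for \<rho>
    using that ranked_matching_toggle(1)[OF M, of \<rho>] by blast
  moreover have "C \<subseteq> K - {toggle (p \<tau>) \<tau>, \<tau>}"
    using ranked_matching_subset[OF M] \<tau> ranked_matching_toggle(1)[OF M \<tau>] by blast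
  ultimately show ?thesis
    unfolding ranked_matching_def[of "K - _"]
  proof (intro conjI ballI impI)
    fix \<rho> assume \<rho>: "\<rho> \<in> K - {toggle (p \<tau>) \<tau>, \<tau>} - C"
    then show "r (toggle (p \<rho>) \<rho>) = r \<rho>"
      by (intro ranked_matching_toggle(2)[OF M]) blast
    fix \<rho>' assume \<rho>': "\<rho>' \<in> K - {toggle (p \<tau>) \<tau>, \<tau>} - C"
    have KC: "\<rho> \<in> K - C" "\<rho>' \<in> K - C" using \<rho> \<rho>' by blast+
    show "r \<rho> \<le> r \<rho>'" if "\<rho> \<subseteq> \<rho>'" by (rule ranked_matching_mono(1)[OF M KC that])
    show "p \<rho> = p \<rho>'" if "r \<rho> = r \<rho>'" by (rule ranked_matching_mono(2)[OF M KC that])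
  qed
qed

text \<open>Among the faces with more than \<open>t\<close> elements, take those of maximal
  cardinality \<open>m\<close>, and among these \<open>\<tau>\<close> of maximal rank. Its pivot
  \<open>v\<close> lies in \<open>\<tau>\<close>, as otherwise the partner would be larger. A face
  \<open>\<rho>\<close> properly containing \<open>\<sigma> = \<tau> - {v}\<close> has
  \<open>m\<close> elements and, by monotonicity and maximality, the rank of \<open>\<tau>\<close>;
  so \<open>v\<close> is its pivot too, \<open>v \<in> \<rho>\<close>, and
  \<open>\<rho> = \<tau>\<close>. Thus \<open>\<sigma>\<close> is free, and the pair is
  collapsed.\<close>

lemma collapse_to_skeleton:
  assumes "abstract_simplicial_complex K" "finite K" "ranked_matching K C r p" "{} \<in> K - C"
    and C: "\<And>\<sigma>. \<sigma> \<in> C \<Longrightarrow> card \<sigma> \<le> t" and t: "1 \<le> t"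
  shows "\<exists>K' \<subseteq> K. abstract_simplicial_complex K' \<and> ranked_matching K' C r p \<and> {} \<in> K' - C \<and>
           (\<forall>\<sigma>\<in>K'. card \<sigma> \<le> t) \<and>
           geometric_realization K homotopy_equivalent_space geometric_realization K'"
  using assms(1-4)
proof (induction "card K" arbitrary: K rule: less_induct)
  case less
  note K = less.prems(1) and M = less.prems(3)
  have fin: "finite \<sigma>" and sub: "\<rho> \<subseteq> \<sigma> \<Longrightarrow> \<rho> \<in> K" if "\<sigma> \<in> K" for \<sigma> \<rho>
    using K that by (auto simp: abstract_simplicial_complex_def)
  show ?case
  proof (cases "\<forall>\<sigma>\<in>K. card \<sigma> \<le> t")
    case True
    then show ?thesis using less.prems homotopy_equivalent_space_refl by blast
  next
    case False
    define A where "A = {\<sigma> \<in> K. card \<sigma> > t}"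
    define m where "m = Max (card ` A)"
    have A: "finite A" "A \<noteq> {}" using less.prems(2) False by (auto simp: A_def not_le)
    have AC: "\<sigma> \<in> K - C" if "\<sigma> \<in> A" for \<sigma> using that C[of \<sigma>] by (auto simp: A_def)
    have m: "card \<sigma> \<le> m" if "\<sigma> \<in> A" for \<sigma> using A that by (simp add: m_def)
    have "m \<in> card ` A" unfolding m_def using A by (intro Max_in) auto
    define B where "B = {\<sigma> \<in> A. card \<sigma> = m}"
    have B: "finite B" "B \<noteq> {}" using A \<open>m \<in> card ` A\<close> by (auto simp: B_def)
    have "Max (r ` B) \<in> r ` B" using B by (intro Max_in) auto
    then obtain \<tau> where \<tau>: "\<tau> \<in> B" "r \<tau> = Max (r ` B)" by auto
    have r_max: "r \<sigma> \<le> r \<tau>" if "\<sigma> \<in> B" for \<sigma> using B \<tau>(2) that by simp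
    have up: "p \<sigma> \<in> \<sigma>" if "\<sigma> \<in> B" for \<sigma>
    proof (rule ccontr)
      assume n: "p \<sigma> \<notin> \<sigma>"
      have \<sigma>: "\<sigma> \<in> A" "card \<sigma> = m" "\<sigma> \<in> K" using that by (auto simp: B_def A_def)
      have "toggle (p \<sigma>) \<sigma> \<in> K" using ranked_matching_toggle(1)[OF M AC[OF \<sigma>(1)]] by blast
      moreover have "card (toggle (p \<sigma>) \<sigma>) = Suc m" using n \<sigma> fin by (simp add: toggle_def)
      moreover have "t < m" using \<sigma> by (auto simp: A_def)
      ultimately have "toggle (p \<sigma>) \<sigma> \<in> A" by (simp add: A_def)
      then show False using m \<open>card (toggle (p \<sigma>) \<sigma>) = Suc m\<close> by fastforce
    qed
    define v \<sigma> where "v = p \<tau>" and "\<sigma> = \<tau> - {v}"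
    have \<tau>A: "\<tau> \<in> A" and card_\<tau>: "card \<tau> = m" and v: "v \<in> \<tau>"
      using \<tau>(1) up by (auto simp: B_def v_def)
    have tog: "toggle (p \<tau>) \<tau> = \<sigma>" and ins: "insert v \<sigma> = \<tau>" "v \<notin> \<sigma>"
      using v by (auto simp: toggle_def v_def \<sigma>_def)
    have \<tau>KC: "\<tau> \<in> K - C" and "t < m" using AC \<tau>A card_\<tau> by (auto simp: A_def)
    have \<sigma>KC: "\<sigma> \<in> K - C" and r\<sigma>: "r \<sigma> = r \<tau>"
      using ranked_matching_toggle[OF M \<tau>KC] tog by auto
    have fin\<tau>: "finite \<tau>" using fin \<tau>KC by blast
    have card_\<sigma>: "card \<sigma> = m - 1" using v card_\<tau> fin\<tau> by (simp add: \<sigma>_def)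
    \<comment> \<open>This is where \<open>1 \<le> t\<close> enters: \<open>m\<close> is at least 2,
      so the empty face is never removed.\<close>
    then have "\<sigma> \<noteq> {}" using \<open>t < m\<close> t by auto
    have free: "\<rho> = \<sigma> \<or> \<rho> = insert v \<sigma>" if \<rho>: "\<rho> \<in> K" "\<sigma> \<subseteq> \<rho>" for \<rho>
    proof (cases "\<rho> = \<sigma>")
      case False
      then have "card \<sigma> < card \<rho>" using \<rho> fin by (intro psubset_card_mono) auto
      then have "t < card \<rho>" "m \<le> card \<rho>" using card_\<sigma> \<open>t < m\<close> by auto
      then have \<rho>B: "\<rho> \<in> B" using \<rho> m by (fastforce simp: A_def B_def)
      then have \<rho>KC: "\<rho> \<in> K - C" using AC by (simp add: B_def)
      have "r \<rho> = r \<tau>"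
        using ranked_matching_mono(1)[OF M \<sigma>KC \<rho>KC \<rho>(2)] r\<sigma> r_max[OF \<rho>B] by simp
      then have "v \<in> \<rho>"
        using up[OF \<rho>B] ranked_matching_mono(2)[OF M \<rho>KC \<tau>KC] by (simp add: v_def)
      then have "\<tau> \<subseteq> \<rho>" using \<rho>(2) ins by blast
      then have "\<tau> = \<rho>"
        using card_\<tau> \<rho>B fin[OF \<rho>(1)] by (intro card_subset_eq) (auto simp: B_def)
      then show ?thesis using ins by simp
    qed simp
    define K1 where "K1 = K - {\<sigma>, \<tau>}"
    have K1: "abstract_simplicial_complex K1"
      unfolding abstract_simplicial_complex_def
    proof (intro conjI ballI allI impI)
      show "finite \<rho>" if "\<rho> \<in> K1" for \<rho> using that fin by (auto simp: K1_def)
      fix \<rho> \<rho>' assume \<rho>: "\<rho> \<in> K1" "\<rho>' \<subseteq> \<rho>"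
      then have "\<not> \<sigma> \<subseteq> \<rho>" using free[of \<rho>] ins by (auto simp: K1_def)
      then show "\<rho>' \<in> K1" using sub[of \<rho> \<rho>'] \<rho> ins by (auto simp: K1_def)
    qed
    have "geometric_realization K homotopy_equivalent_space geometric_realization K1"
      using elementary_collapse[OF K \<open>\<sigma> \<noteq> {}\<close> ins(2) _ _ free] \<sigma>KC \<tau>KC ins(1) by (simp add: K1_def)
    moreover have "ranked_matching K1 C r p"
      using ranked_matching_remove_pair[OF M \<tau>KC] tog by (simp add: K1_def)
    moreover have "card K1 < card K"
      unfolding K1_def using less.prems(2) \<sigma>KC by (intro psubset_card_mono) auto
    moreover have "{} \<in> K1 - C" using less.prems(4) \<open>\<sigma> \<noteq> {}\<close> ins by (auto simp: K1_def)
    moreover have "finite K1" "K1 \<subseteq> K" using less.prems(2) by (auto simp: K1_def)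
    ultimately show ?thesis
      using less.hyps[OF _ K1] homotopy_eqv_trans subset_trans by (metis (no_types, lifting))
  qed
qed

text \<open>Two collapses: first \<open>K\<close> down to faces with at most \<open>d + 1\<close>
  elements, where the critical faces become maximal; then the complex \<open>L\<close> of the
  noncritical faces, which has a matching without critical faces, down to a point.\<close>

theorem ranked_matching_wedge:
  assumes K: "abstract_simplicial_complex K" "finite K" and M: "ranked_matching K C r p" "{} \<in> K - C"
    and C: "\<And>\<sigma>. \<sigma> \<in> C \<Longrightarrow> card \<sigma> = d + 1"
  shows "geometric_realization K homotopy_equivalent_space
    wedge_sum (\<lambda>_. nsphere d) (\<lambda>_. nsphere_base) {..<card C}"
proof -
  obtain K' where K': "K' \<subseteq> K" "abstract_simplicial_complex K'" "ranked_matching K' C r p" "{} \<in> K' - C"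
      "\<And>\<sigma>. \<sigma> \<in> K' \<Longrightarrow> card \<sigma> \<le> d + 1"
    and eq: "geometric_realization K homotopy_equivalent_space geometric_realization K'"
    using collapse_to_skeleton[OF K M, of "d + 1"] C by auto
  have finK': "finite K'" using K' K(2) finite_subset by blast
  have fin: "finite \<sigma>" and sub: "\<rho> \<subseteq> \<sigma> \<Longrightarrow> \<rho> \<in> K'" if "\<sigma> \<in> K'" for \<sigma> \<rho>
    using K'(2) that by (auto simp: abstract_simplicial_complex_def)
  define L where "L = K' - C"
  have CK': "C \<subseteq> K'" using K'(3) by (rule ranked_matching_subset)
  \<comment> \<open>Critical faces have the largest cardinality occurring in \<open>K'\<close>, so
    removing all of them leaves a complex.\<close>
  have not_C: "\<rho> \<notin> C" if "\<rho> \<subset> \<sigma>" "\<sigma> \<in> K'" for \<rho> \<sigma>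
    using psubset_card_mono[OF fin[OF that(2)] that(1)] K'(5)[OF that(2)] C[of \<rho>] by auto
  have L: "abstract_simplicial_complex L"
    unfolding abstract_simplicial_complex_def
  proof (intro conjI ballI allI impI)
    fix \<sigma> \<rho> assume "\<sigma> \<in> L" "\<rho> \<subseteq> \<sigma>"
    then show "\<rho> \<in> L" using not_C[of \<rho> \<sigma>] sub[of \<sigma> \<rho>] by (auto simp: L_def)
  qed (auto simp: L_def fin)
  have "ranked_matching L {} r p" using K'(3) unfolding ranked_matching_def L_def Diff_empty by blast
  moreover have "{} \<in> L - {}" "finite L" using K'(4) finK' by (auto simp: L_def)
  ultimately obtain L' where L': "L' \<subseteq> L" "abstract_simplicial_complex L'" "ranked_matching L' {} r p" "{} \<in> L' - {}"
      "\<And>\<sigma>. \<sigma> \<in> L' \<Longrightarrow> card \<sigma> \<le> 1"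
    and eqL: "geometric_realization L homotopy_equivalent_space geometric_realization L'"
    using collapse_to_skeleton[OF L, of "{}" r p 1] by auto
  define a where "a = p {}"
  have tog0: "toggle a {} = {a}" by (simp add: toggle_def)
  have aL: "{a} \<in> L'" and pa: "p {a} = a"
    using ranked_matching_toggle[OF L'(3,4)] by (simp_all add: tog0 a_def[symmetric])
  \<comment> \<open>The partner of a singleton must again have at most one element, so it is the
    empty face, whose only partner is \<open>{a}\<close>.\<close>
  have L'_eq: "\<sigma> = {} \<or> \<sigma> = {a}" if \<sigma>: "\<sigma> \<in> L'" for \<sigma>
  proof -
    have "finite \<sigma>" using \<sigma> L'(2) by (simp add: abstract_simplicial_complex_def)
    then consider "\<sigma> = {}" | b where "\<sigma> = {b}"
      using L'(5)[OF \<sigma>] by (metis card_0_eq card_1_singletonE le_eq_less_or_eq less_one)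
    then show ?thesis
    proof cases
      case 2
      have "toggle (p \<sigma>) \<sigma> \<in> L'" using ranked_matching_toggle(1)[OF L'(3)] \<sigma> by blast
      then have "card (toggle (p \<sigma>) \<sigma>) \<le> 1" using L'(5) by blast
      then have "p \<sigma> = b" using 2 by (auto simp: toggle_def split: if_splits)
      then have "toggle (p \<sigma>) \<sigma> = {}" using 2 by (simp add: toggle_def)
      then have "p \<sigma> = p {}" using ranked_matching_toggle(3)[OF L'(3), of \<sigma>] \<sigma> by simp
      then show ?thesis using 2 \<open>p \<sigma> = b\<close> by (simp add: a_def)
    qed simp
  qed
  have "realization_points L' = {\<lambda>w. if w = a then 1 else 0}"
  proof -
    have "L' = {{}, {a}}" using L'_eq L'(4) aL by auto
    then have "realization_points L' = std_simplex {} \<union> std_simplex {a}"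
      using realization_points_Union[OF L'(2)] by auto
    also have "\<dots> = {\<lambda>w. if w = a then 1 else 0}"
      by (auto simp: std_simplex_def fun_eq_iff split: if_splits)
    finally show ?thesis .
  qed
  then have "contractible_space (geometric_realization L')"
    by (simp add: geometric_realization_eq)
  then have contr: "contractible_space (geometric_realization L)"
    using eqL homotopy_equivalent_space_contractibility by blast
  have "realization_points L' \<subseteq> realization_points L"
    using L'(1) by (auto simp: realization_points_def)
  then have ne: "realization_points L \<noteq> {}"
    using \<open>realization_points L' = _\<close> by auto
  interpret contractible_plus_cells K' L d
  proof
    show "L \<subseteq> K'" by (auto simp: L_def)
    show "contractible (realization_points L)" using contr by (simp add: geometric_realization_eq)
    show "card \<sigma> = d + 1" if "\<sigma> \<in> K' - L" for \<sigma> using that C by (auto simp: L_def)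
    show "\<tau> \<in> L" if "\<sigma> \<in> K' - L" "\<tau> \<subset> \<sigma>" for \<sigma> \<tau>
      using that not_C[of \<tau> \<sigma>] sub[of \<sigma> \<tau>] by (auto simp: L_def)
  qed (fact K'(2) finK' L ne)+
  have "K' - L = C" using CK' by (auto simp: L_def)
  then show ?thesis using homotopy_equivalent_wedge eq homotopy_eqv_trans by metis
qed

section \<open>Stable sets in the grid\<close>

type_synonym vertex = "nat \<times> nat"

definition adj :: "vertex \<Rightarrow> vertex \<Rightarrow> bool" where
  "adj u v \<longleftrightarrow> fst u = fst v \<and> (snd v = Suc (snd u) \<or> snd u = Suc (snd v)) \<or>
                 snd u = snd v \<and> (fst v = Suc (fst u) \<or> fst u = Suc (fst v))"

definition lex_less :: "vertex \<Rightarrow> vertex \<Rightarrow> bool" where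
  "lex_less u v \<longleftrightarrow> fst u < fst v \<or> fst u = fst v \<and> snd u < snd v"

text \<open>From the first column this leads to second coordinate 0, outside \<open>V\<close>; so
  \<open>left_of x \<in> T\<close> with \<open>T \<subseteq> V\<close> already excludes that column.
  The same holds for \<open>up_of\<close> and the first row.\<close>

definition left_of :: "vertex \<Rightarrow> vertex" where "left_of v = (fst v, snd v - 1)"

definition up_of :: "vertex \<Rightarrow> vertex" where "up_of v = (fst v - 1, snd v)"

definition parent :: "vertex \<Rightarrow> vertex" where
  "parent v = (if 2 \<le> fst v then up_of v else left_of v)"

definition lex_max :: "vertex set \<Rightarrow> vertex" where
  "lex_max T = (THE x. x \<in> T \<and> (\<forall>y\<in>T. y = x \<or> lex_less y x))"

definition stable :: "vertex set \<Rightarrow> bool" where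
  "stable S \<longleftrightarrow> (\<forall>u\<in>S. \<forall>v\<in>S. \<not> adj u v)"

definition has_stable :: "nat \<Rightarrow> vertex set \<Rightarrow> bool" where
  "has_stable k U \<longleftrightarrow> (\<exists>S\<subseteq>U. finite S \<and> card S = k \<and> stable S)"

lemma adj_sym: "adj u v \<Longrightarrow> adj v u"
  by (auto simp: adj_def)

lemma adj_commute: "adj u v \<longleftrightarrow> adj v u"
  using adj_sym by blast

lemma adj_irrefl [simp]: "\<not> adj u u"
  by (auto simp: adj_def)

lemma lex_max_eqI:
  assumes "x \<in> T" "\<And>y. y \<in> T \<Longrightarrow> y = x \<or> lex_less y x"
  shows "lex_max T = x"
  unfolding lex_max_def
proof (intro the_equality conjI ballI)
  fix z assume z: "z \<in> T \<and> (\<forall>y\<in>T. y = z \<or> lex_less y z)"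
  show "z = x"
  proof (rule ccontr)
    assume "z \<noteq> x"
    moreover have "lex_less z x" using assms(2)[of z] z \<open>z \<noteq> x\<close> by simp
    moreover have "x = z \<or> lex_less x z" using z assms(1) by simp
    ultimately show False by (auto simp: lex_less_def)
  qed
qed (use assms in blast)+

lemma lex_max:
  assumes "finite T" "T \<noteq> {}"
  shows "lex_max T \<in> T" and "\<And>y. y \<in> T \<Longrightarrow> y = lex_max T \<or> lex_less y (lex_max T)"
proof -
  have "\<exists>x\<in>T. \<forall>y\<in>T. y = x \<or> lex_less y x"
    using assms
  proof (induction rule: finite_ne_induct)
    case (insert v F)
    then obtain x where x: "x \<in> F" "\<forall>y\<in>F. y = x \<or> lex_less y x" by blast
    have "v = x \<or> lex_less v x \<or> lex_less x v"
      by (auto simp: lex_less_def prod_eq_iff)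
    moreover have "lex_less y v" if "lex_less y x" "lex_less x v" for y
      using that by (auto simp: lex_less_def)
    ultimately show ?case using x by (metis insert_iff)
  qed simp
  then obtain x where x: "x \<in> T" "\<And>y. y \<in> T \<Longrightarrow> y = x \<or> lex_less y x" by blast
  then have "lex_max T = x" by (rule lex_max_eqI)
  then show "lex_max T \<in> T" "\<And>y. y \<in> T \<Longrightarrow> y = lex_max T \<or> lex_less y (lex_max T)"
    using x by auto
qed

lemma has_stable_mono: "has_stable k U \<Longrightarrow> U \<subseteq> U' \<Longrightarrow> has_stable k U'"
  unfolding has_stable_def by blast

lemma has_stable_1: "has_stable 1 U \<longleftrightarrow> U \<noteq> {}"
proof
  assume "U \<noteq> {}"
  then obtain a where "a \<in> U" by blast
  then show "has_stable 1 U"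
    unfolding has_stable_def by (intro exI[of _ "{a}"]) (simp add: stable_def)
qed (auto simp: has_stable_def)

lemma has_stable_2: "has_stable 2 U \<longleftrightarrow> (\<exists>a\<in>U. \<exists>b\<in>U. a \<noteq> b \<and> \<not> adj a b)"
proof
  assume "has_stable 2 U"
  then obtain S where "S \<subseteq> U" "card S = 2" "stable S" by (auto simp: has_stable_def)
  moreover obtain a b where "S = {a, b}" "a \<noteq> b" using \<open>card S = 2\<close> by (meson card_2_iff)
  ultimately have "a \<in> U" "b \<in> U" "\<not> adj a b" by (simp_all add: stable_def)
  then show "\<exists>a\<in>U. \<exists>b\<in>U. a \<noteq> b \<and> \<not> adj a b" using \<open>a \<noteq> b\<close> by blast
next
  assume "\<exists>a\<in>U. \<exists>b\<in>U. a \<noteq> b \<and> \<not> adj a b"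
  then obtain a b where "a \<in> U" "b \<in> U" "a \<noteq> b" "\<not> adj a b" by blast
  then show "has_stable 2 U"
    unfolding has_stable_def
    by (intro exI[of _ "{a, b}"]) (simp add: stable_def adj_commute[of b a])
qed

lemma has_stable_3: "has_stable 3 U \<longleftrightarrow> (\<exists>a\<in>U. \<exists>b\<in>U. \<exists>c\<in>U.
    a \<noteq> b \<and> a \<noteq> c \<and> b \<noteq> c \<and> \<not> adj a b \<and> \<not> adj a c \<and> \<not> adj b c)" (is "_ \<longleftrightarrow> ?R")
proof
  assume "has_stable 3 U"
  then obtain S where "S \<subseteq> U" "card S = 3" "stable S" by (auto simp: has_stable_def)
  moreover obtain a b c where abc: "S = {a, b, c}" "a \<noteq> b" "a \<noteq> c" "b \<noteq> c"
    using \<open>card S = 3\<close> by (metis card_3_iff)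
  ultimately have "a \<in> U" "b \<in> U" "c \<in> U" "\<not> adj a b" "\<not> adj a c" "\<not> adj b c"
    by (simp_all add: stable_def)
  then show ?R using abc by blast
next
  assume ?R
  then obtain a b c where "a \<in> U" "b \<in> U" "c \<in> U"
    "a \<noteq> b" "a \<noteq> c" "b \<noteq> c" "\<not> adj a b" "\<not> adj a c" "\<not> adj b c" by blast
  then show "has_stable 3 U"
    unfolding has_stable_def
    by (intro exI[of _ "{a, b, c}"])
       (simp add: stable_def adj_commute[of b a] adj_commute[of c a] adj_commute[of c b])
qed

text \<open>Dropping \<open>p\<close> removes the only obstacle to adding \<open>x\<close>. It is
  applied with \<open>x\<close> the largest vertex of \<open>T\<close> and \<open>p\<close> its
  parent.\<close>

lemma stable_exchange:
  assumes S: "finite S" "card S = k" "stable S" and "p \<in> S" "x \<notin> S"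
    and nb: "\<And>s. s \<in> S \<Longrightarrow> adj x s \<Longrightarrow> s = p"
  shows "finite (insert x (S - {p}))" "card (insert x (S - {p})) = k" "stable (insert x (S - {p}))"
proof -
  show "card (insert x (S - {p})) = k"
    using assms by (metis DiffE card.remove card_insert_disjoint finite_Diff)
  show "stable (insert x (S - {p}))"
    using S(3) nb unfolding stable_def by (auto dest: adj_sym)
qed (use S in simp)

section \<open>Sets left over after matching with the corner\<close>

abbreviation corner :: vertex where "corner \<equiv> (1, 1)"

abbreviation corner_nbrs :: "vertex set" where "corner_nbrs \<equiv> {(1, 2), (2, 1)}"

definition horizontal :: "vertex set \<Rightarrow> bool" where
  "horizontal T \<longleftrightarrow> 2 \<le> fst (lex_max T) \<and> left_of (lex_max T) \<in> T"

definition remainder :: "vertex set \<Rightarrow> vertex set" where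
  "remainder T = T - {lex_max T, left_of (lex_max T)}"

locale grid =
  fixes m n :: nat
  assumes m2: "2 \<le> m" and n2: "2 \<le> n"
begin

definition V :: "vertex set" where "V = {1..m} \<times> {1..n}"

lemma finite_V: "finite V" and card_V: "card V = m * n"
  by (auto simp: V_def)

lemma finite_sub: "T \<subseteq> V \<Longrightarrow> finite T"
  using finite_V finite_subset by blast

lemma V_iff: "v \<in> V \<longleftrightarrow> 1 \<le> fst v \<and> fst v \<le> m \<and> 1 \<le> snd v \<and> snd v \<le> n"
  by (cases v) (auto simp: V_def)

lemma grid_edge_iff:
  assumes "u \<in> V" "v \<in> V"
  shows "{u, v} \<in> edges (grid_graph m n) \<longleftrightarrow> adj u v"
proof -
  obtain a b c d where uv: "u = (a, b)" "v = (c, d)" by (metis surj_pair)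
  show ?thesis
    using assms unfolding uv by (auto simp: grid_graph_def adj_def V_iff doubleton_eq_iff)
qed

lemma total_cut_complex_eq:
  "total_cut_complex k (grid_graph m n) = {W. W \<subseteq> V \<and> has_stable k (V - W)}"
proof -
  have verts: "verts (grid_graph m n) = V" by (simp add: grid_graph_def V_def)
  have ind: "independent_set (grid_graph m n) S \<longleftrightarrow> stable S" if "S \<subseteq> V" for S
  proof -
    have "{u, v} \<in> edges (grid_graph m n) \<longleftrightarrow> adj u v" if "u \<in> S" "v \<in> S" for u v
      using grid_edge_iff \<open>S \<subseteq> V\<close> that by blast
    then show ?thesis using that by (simp add: independent_set_def verts stable_def)
  qed
  have "(\<exists>S\<subseteq>V - W. independent_set (grid_graph m n) S \<and> finite S \<and> card S = k) \<longleftrightarrow>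
      has_stable k (V - W)" for W
  proof -
    have "independent_set (grid_graph m n) S \<longleftrightarrow> stable S" if "S \<subseteq> V - W" for S
      by (rule ind) (use that in blast)
    then show ?thesis unfolding has_stable_def by (simp cong: conj_cong) blast
  qed
  then show ?thesis
    unfolding total_cut_complex_def verts by simp
qed

text \<open>By \<open>residual_iff\<close> below, these are the sets left over, without their corner, when faces are
  matched by toggling the corner in the complement.\<close>

definition residual :: "nat \<Rightarrow> vertex set \<Rightarrow> bool" where
  "residual k T \<longleftrightarrow> T \<subseteq> V - {corner} \<and> \<not> has_stable k T \<and> has_stable (k - 1) (T - corner_nbrs)"

lemma corner_V: "corner \<in> V" using m2 n2 by (simp add: V_iff)

text \<open>If the corner cannot be spared, every stable set of size \<open>k\<close> in
  \<open>U\<close> contains it, and its other members avoid the two neighbours of the corner.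
  Conversely the corner can be added to any stable set that avoids these two.\<close>

lemma residual_iff:
  assumes U: "U \<subseteq> V" and k: "1 \<le> k"
  shows "has_stable k U \<and> \<not> has_stable k (U - {corner}) \<longleftrightarrow> corner \<in> U \<and> residual k (U - {corner})"
proof
  assume R: "has_stable k U \<and> \<not> has_stable k (U - {corner})"
  then obtain S where S: "S \<subseteq> U" "finite S" "card S = k" "stable S" by (auto simp: has_stable_def)
  have c: "corner \<in> S"
  proof (rule ccontr)
    assume "corner \<notin> S"
    then have "S \<subseteq> U - {corner}" using S by blast
    then show False using S R by (auto simp: has_stable_def)
  qed
  have "adj corner (1, 2)" "adj corner (2, 1)" by (auto simp: adj_def)
  then have "S - {corner} \<subseteq> U - {corner} - corner_nbrs"
    using S c by (auto simp: stable_def)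
  moreover have "card (S - {corner}) = k - 1" "finite (S - {corner})" "stable (S - {corner})"
    using S c by (auto simp: stable_def)
  ultimately show "corner \<in> U \<and> residual k (U - {corner})"
    using R U S c unfolding residual_def has_stable_def by (intro conjI) blast+
next
  assume R: "corner \<in> U \<and> residual k (U - {corner})"
  then obtain S where S: "S \<subseteq> U - {corner} - corner_nbrs" "finite S" "card S = k - 1" "stable S"
    by (auto simp: residual_def has_stable_def)
  have nadj: "\<not> adj corner s" if "s \<in> S" for s
  proof -
    have "s \<in> V" "s \<noteq> (1, 2)" "s \<noteq> (2, 1)" using S U that by auto
    then show ?thesis by (auto simp: adj_def V_iff prod_eq_iff)
  qed
  have "stable (insert corner S)" using S(4) nadj by (auto simp: stable_def dest: adj_sym)
  moreover have "card (insert corner S) = k" using S k by (subst card_insert_disjoint) auto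
  moreover have "insert corner S \<subseteq> U" using R S by auto
  ultimately have "has_stable k U" using S(2) unfolding has_stable_def by blast
  then show "has_stable k U \<and> \<not> has_stable k (U - {corner})" using R by (simp add: residual_def)
qed

lemma residual_V: "residual k T \<Longrightarrow> t \<in> T \<Longrightarrow> t \<in> V \<and> t \<noteq> corner"
  by (auto simp: residual_def)

lemma residual_finite: "residual k T \<Longrightarrow> finite T"
  by (auto simp: residual_def intro: finite_sub)

lemma residual_nonempty: "residual k T \<Longrightarrow> 2 \<le> k \<Longrightarrow> T \<noteq> {}"
  by (auto simp: residual_def has_stable_def)

lemma residual_lex_max:
  assumes "residual k T" "2 \<le> k"
  shows "lex_max T \<in> T" "lex_max T \<in> V" "lex_max T \<noteq> corner"
    "\<And>t. t \<in> T \<Longrightarrow> t = lex_max T \<or> lex_less t (lex_max T)"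
proof -
  note mx = lex_max[OF residual_finite[OF assms(1)] residual_nonempty[OF assms]]
  show "lex_max T \<in> T" by (fact mx(1))
  then show "lex_max T \<in> V" "lex_max T \<noteq> corner" using residual_V[OF assms(1)] by simp_all
  show "\<And>t. t \<in> T \<Longrightarrow> t = lex_max T \<or> lex_less t (lex_max T)" by (fact mx(2))
qed

text \<open>\<open>corner_nbrs\<close> are the two vertices whose parent is the corner itself. The
  last claim ensures that toggling the parent does not affect the test for
  \<open>horizontal\<close>.\<close>

lemma parent_props:
  assumes "x \<in> V" "x \<noteq> corner" "x \<notin> corner_nbrs"
  shows "parent x \<in> V" "parent x \<noteq> corner" "lex_less (parent x) x" "adj x (parent x)"
    "2 \<le> fst x \<Longrightarrow> parent x \<noteq> left_of x"
proof -
  obtain a b where x: "x = (a, b)" by (cases x)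
  then have ab: "1 \<le> a" "a \<le> m" "1 \<le> b" "b \<le> n" "(a, b) \<noteq> (1, 1)" "(a, b) \<noteq> (1, 2)" "(a, b) \<noteq> (2, 1)"
    using assms by (auto simp: V_iff)
  show "parent x \<in> V" "parent x \<noteq> corner" "lex_less (parent x) x" "adj x (parent x)"
    "2 \<le> fst x \<Longrightarrow> parent x \<noteq> left_of x"
    using ab unfolding x
    by (auto simp: V_iff parent_def up_of_def left_of_def lex_less_def adj_def)
qed

text \<open>Here the parent of the largest vertex is its only possible neighbour in \<open>T\<close>, so in a stable set
  one may be exchanged for the other.\<close>

lemma residual_not_horizontal:
  assumes T: "residual k T" and k: "2 \<le> k" and nh: "\<not> horizontal T"
  defines "x \<equiv> lex_max T"
  shows "parent x \<in> V" "parent x \<noteq> corner" "residual k (toggle (parent x) T)"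
    "lex_max (toggle (parent x) T) = x" "\<not> horizontal (toggle (parent x) T)"
proof -
  note x = residual_lex_max[OF T k, folded x_def]
  have stab: "\<not> has_stable k T" using T by (simp add: residual_def)
  obtain S where S: "S \<subseteq> T - corner_nbrs" "finite S" "card S = k - 1" "stable S"
    using T by (auto simp: residual_def has_stable_def)
  \<comment> \<open>\<open>S\<close> is nonempty as \<open>k \<ge> 2\<close>, and its members lie
    below \<open>x\<close>, away from the corner and its neighbours. This rules out
    \<open>(1, 2)\<close>. For \<open>x = (2, 1)\<close> they lie in the first row from column 3 on,
    and adding \<open>x\<close> would give a stable set of size \<open>k\<close> in
    \<open>T\<close>.\<close>
  have "x \<notin> corner_nbrs"
  proof
    assume "x \<in> corner_nbrs"
    have below: "lex_less s x" "s \<in> V" "s \<noteq> corner" "s \<notin> corner_nbrs" if "s \<in> S" for s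
      using x(4)[of s] residual_V[OF T, of s] S(1) that \<open>x \<in> corner_nbrs\<close> by auto
    obtain s where "s \<in> S" using S(3) k by (metis card.empty diff_is_0_eq ex_in_conv not_less_eq_eq numeral_2_eq_2 One_nat_def)
    then have x21: "x = (2, 1)"
      using below[of s] \<open>x \<in> corner_nbrs\<close> by (auto simp: lex_less_def V_iff prod_eq_iff)
    have "\<not> adj x s" if "s \<in> S" for s
      using below[OF that] by (auto simp: x21 lex_less_def V_iff prod_eq_iff adj_def)
    then have "stable (insert x S)" using S(4) by (auto simp: stable_def dest: adj_sym)
    moreover have "card (insert x S) = k"
      using S \<open>x \<in> corner_nbrs\<close> k by (subst card_insert_disjoint) auto
    ultimately have "has_stable k T"
      unfolding has_stable_def using S x(1) by (intro exI[of _ "insert x S"]) auto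
    then show False using stab by blast
  qed
  note p = parent_props[OF x(2,3) this]
  show "parent x \<in> V" "parent x \<noteq> corner" by (fact p)+
  \<comment> \<open>As \<open>x\<close> is largest, a neighbour in \<open>T\<close> is to the left
    or above. The one that is not the parent is excluded by \<open>\<not> horizontal T\<close>, or,
    in the first row, lies outside the grid.\<close>
  have nb: "t = parent x" if t: "t \<in> T" "adj x t" for t
  proof -
    have "lex_less t x" using x(4)[OF t(1)] t(2) by auto
    then have "t = left_of x \<or> t = up_of x"
      using t(2) by (auto simp: adj_def lex_less_def left_of_def up_of_def prod_eq_iff)
    moreover have "\<not> (2 \<le> fst x \<and> t = left_of x)"
      using nh t(1) by (auto simp: horizontal_def x_def)
    moreover have "\<not> (fst x < 2 \<and> t = up_of x)"
      using residual_V[OF T t(1)] x(2) t(2) by (auto simp: V_iff up_of_def adj_def)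
    ultimately show ?thesis by (auto simp: parent_def)
  qed
  \<comment> \<open>The exchange is used in both directions: adding the parent creates no stable set
    of size \<open>k\<close>, and (\<open>del\<close>) removing it destroys no stable set of size
    \<open>k - 1\<close> away from \<open>corner_nbrs\<close>, because \<open>x\<close> takes its
    place.\<close>
  have ins: "\<not> has_stable k (insert (parent x) T)"
  proof
    assume "has_stable k (insert (parent x) T)"
    then obtain S' where S': "S' \<subseteq> insert (parent x) T" "finite S'" "card S' = k" "stable S'"
      by (auto simp: has_stable_def)
    show False
    proof (cases "parent x \<in> S'")
      case True
      then have "x \<notin> S'" using S'(4) p(4) by (auto simp: stable_def)
      have "s = parent x" if "s \<in> S'" "adj x s" for s
        using nb[of s] that S'(1) by blast
      note ex = stable_exchange[OF S'(2-4) True \<open>x \<notin> S'\<close> this]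
      have "insert x (S' - {parent x}) \<subseteq> T" using S'(1) x(1) by blast
      then show False using ex stab unfolding has_stable_def by blast
    next
      case False
      then have "S' \<subseteq> T" using S'(1) by blast
      then show False using S' stab unfolding has_stable_def by blast
    qed
  qed
  have del: "has_stable (k - 1) (T - {parent x} - corner_nbrs)"
  proof (cases "parent x \<in> S")
    case True
    then have "x \<notin> S" using S(4) p(4) by (auto simp: stable_def)
    have "s = parent x" if "s \<in> S" "adj x s" for s
      using nb[of s] that S(1) by blast
    note ex = stable_exchange[OF S(2-4) True \<open>x \<notin> S\<close> this]
    have "insert x (S - {parent x}) \<subseteq> T - {parent x} - corner_nbrs"
      using S(1) x(1) \<open>x \<notin> corner_nbrs\<close> p(4) by auto
    then show ?thesis using ex unfolding has_stable_def by blast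
  next
    case False
    then have "S \<subseteq> T - {parent x} - corner_nbrs" using S(1) by blast
    then show ?thesis using S unfolding has_stable_def by blast
  qed
  have TV: "T \<subseteq> V - {corner}" using T by (simp add: residual_def)
  show "residual k (toggle (parent x) T)"
  proof (cases "parent x \<in> T")
    case True
    then have "\<not> has_stable k (T - {parent x})" using stab has_stable_mono by blast
    then show ?thesis using True TV del by (auto simp: toggle_def residual_def)
  next
    case False
    have "has_stable (k - 1) (insert (parent x) T - corner_nbrs)"
      by (rule has_stable_mono[of _ "T - corner_nbrs"]) (use T in \<open>auto simp: residual_def\<close>)
    then show ?thesis using False TV ins p by (simp add: toggle_def residual_def)
  qed
  show mx: "lex_max (toggle (parent x) T) = x"
    by (rule lex_max_eqI) (use x p in \<open>auto simp: toggle_def split: if_splits\<close>)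
  show "\<not> horizontal (toggle (parent x) T)"
    using nh p(5) unfolding horizontal_def mx by (auto simp: toggle_def x_def split: if_splits)
qed

end

lemma adj_Pair: "adj (a, b) (c, d) \<longleftrightarrow>
    a = c \<and> (d = Suc b \<or> b = Suc d) \<or> b = d \<and> (c = Suc a \<or> a = Suc c)"
  by (simp add: adj_def)

lemma lex_less_Pair: "lex_less (a, b) (c, d) \<longleftrightarrow> a < c \<or> a = c \<and> b < d"
  by (simp add: lex_less_def)

lemma left_of_Pair: "left_of (a, Suc b) = (a, b)"
  by (simp add: left_of_def)

lemma up_of_Pair: "up_of (Suc a, b) = (a, b)"
  by (simp add: up_of_def)

lemmas coordinate_simps = adj_Pair lex_less_Pair left_of_Pair up_of_Pair

text \<open>The grid is bipartite.\<close>

lemma no_triangle: "\<not> (adj a b \<and> adj b c \<and> adj a c)"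
  by (cases a; cases b; cases c) (auto simp: adj_Pair)

section \<open>Horizontal edges and the shape of the unmatched sets\<close>

context grid
begin

text \<open>A vertex of \<open>H\<close> stands for the horizontal edge ending in it, that is, for
  an edge outside the spanning tree, or equivalently for a unit square of the grid.\<close>

definition H :: "vertex set" where "H = {2..m} \<times> {2..n}"

lemma H_iff: "v \<in> H \<longleftrightarrow> 2 \<le> fst v \<and> fst v \<le> m \<and> 2 \<le> snd v \<and> snd v \<le> n"
  by (cases v) (auto simp: H_def)

lemma H_cases:
  assumes "x \<in> H"
  obtains a b where "x = (Suc a, Suc b)" "1 \<le> a" "1 \<le> b" "Suc a \<le> m" "Suc b \<le> n"
  using assms by (cases x; cases "fst x"; cases "snd x") (auto simp: H_iff)

lemma V_cases:
  assumes "x \<in> V"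
  obtains a b where "x = (a, b)" "1 \<le> a" "1 \<le> b" "a \<le> m" "b \<le> n"
  using assms by (cases x) (auto simp: V_iff)

lemma card_H: "card H = (m - 1) * (n - 1)"
  by (simp add: H_def card_cartesian_product)

lemma left_of_H:
  assumes "x \<in> H"
  shows "left_of x \<in> V" "left_of x \<noteq> corner" "lex_less (left_of x) x" "adj x (left_of x)" "left_of x \<noteq> x"
  using assms by (auto elim!: H_cases simp: V_iff coordinate_simps)

text \<open>\<open>left_of x\<close> is the immediate lexicographic predecessor of \<open>x\<close>,
  so everything else in \<open>T\<close> lies below the whole edge.\<close>

lemma residual_horizontal:
  assumes T: "residual k T" and k: "2 \<le> k" and h: "horizontal T"
  shows "lex_max T \<in> H" "lex_max T \<notin> corner_nbrs"
    "T = insert (lex_max T) (insert (left_of (lex_max T)) (remainder T))"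
    "\<And>t. t \<in> remainder T \<Longrightarrow> t \<in> T \<and> lex_less t (left_of (lex_max T)) \<and> t \<in> V \<and> t \<noteq> corner"
proof -
  define x where "x = lex_max T"
  note x = residual_lex_max[OF T k, folded x_def]
  have l: "2 \<le> fst x" "left_of x \<in> T" using h by (auto simp: horizontal_def x_def)
  have "left_of x \<in> V" using residual_V[OF T l(2)] by blast
  then have "x \<in> H" using x(2) l(1) by (auto simp: H_iff V_iff left_of_def)
  then show "lex_max T \<in> H" by (simp add: x_def)
  then show "lex_max T \<notin> corner_nbrs" by (auto simp: H_iff)
  show "T = insert (lex_max T) (insert (left_of (lex_max T)) (remainder T))"
    using x(1) l(2) by (auto simp: remainder_def x_def)
  fix t assume "t \<in> remainder T"
  then have t: "t \<in> T" "t \<noteq> x" "t \<noteq> left_of x" by (auto simp: remainder_def x_def)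
  then have "lex_less t x" using x(4) by blast
  then have "lex_less t (left_of x)"
    using t(3) \<open>x \<in> H\<close> by (cases x; cases t; auto simp: lex_less_def left_of_def)
  then show "t \<in> T \<and> lex_less t (left_of (lex_max T)) \<and> t \<in> V \<and> t \<noteq> corner"
    using t(1) residual_V[OF T t(1)] by (simp add: x_def)
qed

lemma lex_max_remainder_insert:
  assumes x: "x \<in> H" and R: "\<And>t. t \<in> R \<Longrightarrow> lex_less t (left_of x)"
  defines "T \<equiv> insert x (insert (left_of x) R)"
  shows "lex_max T = x" "remainder T = R" "horizontal T"
proof -
  have below: "lex_less t x \<and> t \<noteq> x \<and> t \<noteq> left_of x" if "t \<in> R" for t
    using R[OF that] left_of_H(3)[OF x] by (auto simp: lex_less_def)
  show mx: "lex_max T = x"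
    by (rule lex_max_eqI) (use below left_of_H(3)[OF x] in \<open>auto simp: T_def\<close>)
  show "remainder T = R" using below unfolding remainder_def mx by (auto simp: T_def)
  show "horizontal T" using x unfolding horizontal_def mx by (auto simp: T_def H_iff)
qed

text \<open>Pigeonhole: of three vertices covered by two edges, two lie on the same edge.\<close>

lemma no_stable_3_two_edges:
  assumes "adj a b" "adj c d"
  shows "\<not> has_stable 3 {a, b, c, d}"
proof
  assume "has_stable 3 {a, b, c, d}"
  then have "has_stable 3 ({a, b} \<union> {c, d})" by (simp add: insert_commute)
  then obtain u v w where uvw: "u \<in> {a, b} \<union> {c, d}" "v \<in> {a, b} \<union> {c, d}" "w \<in> {a, b} \<union> {c, d}"
      "u \<noteq> v" "u \<noteq> w" "v \<noteq> w" "\<not> adj u v" "\<not> adj u w" "\<not> adj v w"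
    unfolding has_stable_3 by blast
  have "adj p q" if "p \<in> {a, b} \<and> q \<in> {a, b} \<or> p \<in> {c, d} \<and> q \<in> {c, d}" "p \<noteq> q" for p q
    using that assms by (auto dest: adj_sym)
  then show False using uvw by blast
qed

text \<open>A set without a stable pair is a clique, and a third vertex next to the edge would
  complete a triangle.\<close>

lemma residual_2_horizontal_iff:
  "residual 2 T \<and> horizontal T \<longleftrightarrow> (\<exists>x\<in>H. T = {x, left_of x})"
proof
  assume R: "residual 2 T \<and> horizontal T"
  define x where "x = lex_max T"
  note x = residual_horizontal[of 2 T, folded x_def]
  have "remainder T = {}"
  proof (rule ccontr)
    assume "remainder T \<noteq> {}"
    then obtain t where "t \<in> remainder T" by blast
    then have t: "t \<in> T" "lex_less t (left_of x)" using R x(4) by auto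
    have xT: "x \<in> T" "left_of x \<in> T" using R x(3) by auto
    have "x \<in> H" using R x(1) by auto
    have "\<not> has_stable 2 T" using R by (simp add: residual_def)
    then have "t = x \<or> adj t x" "t = left_of x \<or> adj t (left_of x)"
      using t(1) xT unfolding has_stable_2 by blast+
    then show False
      using t(2) \<open>x \<in> H\<close> by (cases x; cases t; auto simp: lex_less_def left_of_def adj_def H_iff)
  qed
  then show "\<exists>x\<in>H. T = {x, left_of x}" using R x(1,3) by auto
next
  assume "\<exists>x\<in>H. T = {x, left_of x}"
  then obtain x where x: "x \<in> H" "T = {x, left_of x}" by blast
  have "\<not> has_stable 2 T" unfolding x(2) has_stable_2 using left_of_H[OF x(1)] by (auto dest: adj_sym)
  moreover have "x \<notin> corner_nbrs" "x \<noteq> corner" "x \<in> V" using x(1) by (auto simp: H_iff V_iff)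
  ultimately have "residual 2 T"
    using left_of_H[OF x(1)] has_stable_1[of "T - corner_nbrs"] by (auto simp: residual_def x(2))
  moreover have "horizontal T" using lex_max_remainder_insert(3)[OF x(1), of "{}"] x(2) by simp
  ultimately show "residual 2 T \<and> horizontal T" by blast
qed

text \<open>If \<open>s\<close> and \<open>t\<close> are not adjacent, neither \<open>x\<close> nor
  \<open>left_of x\<close> may complete them to a stable triple, so each is adjacent to one of
  \<open>s\<close>, \<open>t\<close>. Below the edge, \<open>x\<close> has only the neighbour
  \<open>up_of x\<close>, and \<open>left_of x\<close> only its own left and upper neighbours. The
  latter is adjacent to \<open>up_of x\<close>, which leaves the exceptional pair.\<close>

lemma remainder_pair:
  assumes T: "residual 3 T" and h: "horizontal T" and t: "s \<in> remainder T" "t \<in> remainder T" "s \<noteq> t"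
  defines "x \<equiv> lex_max T"
  shows "adj s t \<or> {s, t} = {left_of (left_of x), up_of x}"
proof (rule ccontr)
  assume n: "\<not> ?thesis"
  note x = residual_horizontal[OF T _ h, folded x_def, simplified]
  have xT: "x \<in> T" "left_of x \<in> T" using x(3) by auto
  have st: "s \<in> T" "t \<in> T" "lex_less s (left_of x)" "lex_less t (left_of x)" "s \<in> V" "t \<in> V"
    using x(4) t by auto
  have "\<not> has_stable 3 T" using T by (simp add: residual_def)
  then have "adj s t \<or> s = x \<or> t = x \<or> adj s x \<or> adj t x"
    "adj s t \<or> s = left_of x \<or> t = left_of x \<or> adj s (left_of x) \<or> adj t (left_of x)"
    using xT st(1,2) t(3) unfolding has_stable_3 by blast+
  note near = this
  have nbr: "adj u x \<Longrightarrow> u = up_of x"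
    "adj u (left_of x) \<Longrightarrow> u = left_of (left_of x) \<or> u = up_of (left_of x)"
    if "u \<in> {s, t}" for u
    using that st(3-6) x(1)
    by (auto elim!: H_cases V_cases simp: coordinate_simps left_of_def)
  have "s \<notin> {x, left_of x}" "t \<notin> {x, left_of x}"
    using t by (auto simp: remainder_def x_def)
  moreover have "up_of x \<noteq> left_of (left_of x)" "up_of x \<noteq> up_of (left_of x)"
    "adj (up_of x) (up_of (left_of x))"
    using x(1) by (auto elim!: H_cases simp: coordinate_simps left_of_def)
  ultimately show False
    using n near nbr[of s] nbr[of t] adj_commute[of s t] by (auto simp: doubleton_eq_iff)
qed

lemma remainder_3_nonempty:
  assumes T: "residual 3 T" and h: "horizontal T"
  shows "remainder T \<noteq> {}" "finite (remainder T)"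
proof
  note x = residual_horizontal[OF T _ h, simplified]
  assume "remainder T = {}"
  then have "T = {lex_max T, left_of (lex_max T)}" using x(3) by simp
  moreover have "has_stable 2 (T - corner_nbrs)" using T by (simp add: residual_def)
  then have "has_stable 2 T" by (rule has_stable_mono) blast
  ultimately show False
    using left_of_H(4)[OF x(1)] unfolding has_stable_2
    by (metis adj_commute insert_iff singletonD)
qed (use residual_finite[OF T] in \<open>simp add: remainder_def\<close>)

text \<open>The domain of the second toggling step, closed under adding or removing the parent of
  the largest vertex.\<close>

definition collapsible_remainder :: "vertex set \<Rightarrow> bool" where
  "collapsible_remainder R \<longleftrightarrow> R = {lex_max R} \<or> R = {lex_max R, parent (lex_max R)}"

text \<open>\<open>T\<close> consists of the edge at \<open>x\<close> and of \<open>z\<close>, with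
  or without its parent. Both sets are covered by two edges, hence have no stable triple, and the
  required stable pair is found without using the parent.\<close>

lemma residual_3_collapsible:
  assumes T: "residual 3 T" and h: "horizontal T" and c: "collapsible_remainder (remainder T)"
  defines "x \<equiv> lex_max T" and "z \<equiv> lex_max (remainder T)"
  shows "parent z \<in> V" "parent z \<noteq> corner" "residual 3 (toggle (parent z) T)"
    "horizontal (toggle (parent z) T)" "lex_max (toggle (parent z) T) = x"
    "lex_max (remainder (toggle (parent z) T)) = z"
    "collapsible_remainder (remainder (toggle (parent z) T))"
proof -
  let ?R = "remainder T"
  note x = residual_horizontal[OF T _ h, folded x_def, simplified]
  have zR: "z \<in> ?R"
    using lex_max(1) remainder_3_nonempty[OF T h] by (simp add: z_def)
  note z = x(4)[OF zR]
  \<comment> \<open>The parent of \<open>z\<close> would be the corner, which is not in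
    \<open>T\<close>. So \<open>z\<close> would be the whole remainder, and away from
    \<open>corner_nbrs\<close> at most one edge would be left, without a stable pair.\<close>
  have "z \<notin> corner_nbrs"
  proof
    assume zc: "z \<in> corner_nbrs"
    then have "parent z = corner" by (auto simp: parent_def up_of_def left_of_def)
    then have "?R = {z}" using c x(4)[of corner] by (auto simp: collapsible_remainder_def z_def)
    then have "T - corner_nbrs \<subseteq> {x, left_of x}" using x(3) zc by auto
    moreover have "has_stable 2 (T - corner_nbrs)" using T by (simp add: residual_def)
    ultimately have "has_stable 2 {x, left_of x}" using has_stable_mono by blast
    then show False
      using left_of_H(4)[OF x(1)] unfolding has_stable_2
      by (metis adj_commute insert_iff singletonD)
  qed
  note p = parent_props[OF _ _ this] z
  show pV: "parent z \<in> V" "parent z \<noteq> corner" using p by auto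
  have pz: "lex_less (parent z) z" "adj z (parent z)" using p by auto
  define A where "A R = insert x (insert (left_of x) R)" for R
  have below: "lex_less t (left_of x)" if "t \<in> {z, parent z}" for t
    using that z pz(1) by (auto simp: lex_less_def)
  have A: "lex_max (A R) = x" "remainder (A R) = R" "horizontal (A R)" if "R \<subseteq> {z, parent z}" for R
    using lex_max_remainder_insert[OF x(1), of R] below that unfolding A_def by blast+
  have pA: "parent z \<noteq> x" "parent z \<noteq> left_of x" "parent z \<noteq> z"
    using below[of "parent z"] left_of_H(3)[OF x(1)] pz by (auto simp: lex_less_def)
  have T_cases: "T = A {z} \<or> T = A {z, parent z}"
    using c x(3) by (auto simp: collapsible_remainder_def z_def[symmetric] A_def)
  then have tog: "toggle (parent z) T = A {z, parent z} \<or> toggle (parent z) T = A {z}"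
    using pA by (auto simp: toggle_def A_def)
  have mz: "lex_max R = z" if "R = {z} \<or> R = {z, parent z}" for R
    by (rule lex_max_eqI) (use that pz in auto)
  have ns: "\<not> has_stable 3 (A {z, parent z})"
    using no_stable_3_two_edges[OF left_of_H(4)[OF x(1)] pz(2)] by (simp add: A_def)
  then have ns': "\<not> has_stable 3 (A {z})"
    using has_stable_mono[of 3 "A {z}" "A {z, parent z}"] by (auto simp: A_def)
  have "\<exists>a b. a \<in> A {z} - corner_nbrs \<and> b \<in> A {z} - corner_nbrs \<and> a \<noteq> b \<and> \<not> adj a b"
  proof (cases "adj x z")
    case False
    then have "x \<in> A {z} - corner_nbrs \<and> z \<in> A {z} - corner_nbrs \<and> x \<noteq> z \<and> \<not> adj x z"
      using x(2) \<open>z \<notin> corner_nbrs\<close> below[of z] left_of_H(3)[OF x(1)]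
      by (auto simp: A_def lex_less_def)
    then show ?thesis by blast
  next
    \<comment> \<open>Here \<open>z = up_of x\<close>. The vertex \<open>left_of x\<close> avoids
      \<open>corner_nbrs\<close>, since \<open>left_of x = (2, 1)\<close> would force
      \<open>z = (1, 2)\<close>.\<close>
    case True
    have "left_of x \<in> A {z} - corner_nbrs \<and> z \<in> A {z} - corner_nbrs \<and> left_of x \<noteq> z \<and> \<not> adj (left_of x) z"
      using True x(1) z \<open>z \<notin> corner_nbrs\<close>
      by (auto elim!: H_cases V_cases simp: A_def coordinate_simps)
    then show ?thesis by blast
  qed
  then have s2: "has_stable 2 (A {z} - corner_nbrs)" unfolding has_stable_2 by blast
  then have s2': "has_stable 2 (A {z, parent z} - corner_nbrs)"
    by (rule has_stable_mono) (auto simp: A_def)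
  have AV: "A {z, parent z} \<subseteq> V - {corner}"
    using x(1) left_of_H[OF x(1)] z pV by (auto simp: A_def H_iff V_iff)
  then have AV': "A {z} \<subseteq> V - {corner}" by (auto simp: A_def)
  show "residual 3 (toggle (parent z) T)"
    using tog ns ns' s2 s2' AV AV' by (auto simp: residual_def)
  show "horizontal (toggle (parent z) T)" "lex_max (toggle (parent z) T) = x"
    using tog A[of "{z}"] A[of "{z, parent z}"] by auto
  have R: "remainder (toggle (parent z) T) = {z, parent z} \<or> remainder (toggle (parent z) T) = {z}"
    using tog A[of "{z}"] A[of "{z, parent z}"] by auto
  then show "lex_max (remainder (toggle (parent z) T)) = z" using mz by blast
  then show "collapsible_remainder (remainder (toggle (parent z) T))"
    using R by (auto simp: collapsible_remainder_def)
qed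

text \<open>The pair of horizontal edges ending in \<open>z\<close> and \<open>x\<close>; if they share the vertex
  \<open>z = left_of x\<close>, this vertex cannot be used twice and \<open>up_of x\<close> replaces it.\<close>
definition edge_pair :: "vertex \<Rightarrow> vertex \<Rightarrow> vertex set" where
  "edge_pair z x = {x, left_of x} \<union>
     (if z = left_of x then {left_of z, up_of x} else {z, left_of z})"

lemma edge_pair:
  assumes z: "z \<in> H" and x: "x \<in> H" and zx: "lex_less z x"
  shows "residual 3 (edge_pair z x)" "horizontal (edge_pair z x)" "lex_max (edge_pair z x) = x"
    "\<not> collapsible_remainder (remainder (edge_pair z x))"
    "remainder (edge_pair z x) = (if z = left_of x then {left_of z, up_of x} else {z, left_of z})"
    "card (edge_pair z x) = 4"
proof -
  define R where "R = (if z = left_of x then {left_of z, up_of x} else {z, left_of z})"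
  have EP: "edge_pair z x = insert x (insert (left_of x) R)" by (simp add: edge_pair_def R_def)
  have below: "lex_less t (left_of x)" if "t \<in> R" for t
    using that z x zx by (auto elim!: H_cases simp: R_def coordinate_simps split: if_splits)
  have E: "lex_max (edge_pair z x) = x" "remainder (edge_pair z x) = R" "horizontal (edge_pair z x)"
    using lex_max_remainder_insert[OF x, of R] below unfolding EP by blast+
  show "lex_max (edge_pair z x) = x" by (fact E(1))
  show "horizontal (edge_pair z x)" by (fact E(3))
  show rem: "remainder (edge_pair z x) = (if z = left_of x then {left_of z, up_of x} else {z, left_of z})"
    using E(2) by (simp add: R_def)
  have ns: "\<not> has_stable 3 (edge_pair z x)"
  proof (cases "z = left_of x")
    case True
    \<comment> \<open>With a shared vertex the four vertices are still covered by two disjoint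
      edges, one of them now the vertical edge at \<open>x\<close>.\<close>
    have "adj (left_of x) (left_of z)" "adj x (up_of x)"
      using x z True by (auto elim!: H_cases simp: coordinate_simps)
    from no_stable_3_two_edges[OF this] show ?thesis
      unfolding edge_pair_def using True by (simp add: insert_commute)
  next
    case False
    from no_stable_3_two_edges[OF left_of_H(4)[OF x] left_of_H(4)[OF z]] show ?thesis
      unfolding edge_pair_def using False by (simp add: insert_commute)
  qed
  have s2: "has_stable 2 (edge_pair z x - corner_nbrs)"
  proof -
    have "\<exists>a b. a \<in> edge_pair z x - corner_nbrs \<and> b \<in> edge_pair z x - corner_nbrs \<and> a \<noteq> b \<and> \<not> adj a b"
    proof (cases "z = left_of x")
      case True
      have "left_of x \<in> edge_pair z x - corner_nbrs \<and> up_of x \<in> edge_pair z x - corner_nbrs \<and>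
          left_of x \<noteq> up_of x \<and> \<not> adj (left_of x) (up_of x)"
        using x z True by (auto elim!: H_cases simp: edge_pair_def coordinate_simps)
      then show ?thesis by blast
    next
      case False
      show ?thesis
      proof (cases "adj x z")
        case True
        have "left_of x \<in> edge_pair z x - corner_nbrs \<and> z \<in> edge_pair z x - corner_nbrs \<and>
          left_of x \<noteq> z \<and> \<not> adj (left_of x) z"
          using x z False True zx
          by (auto elim!: H_cases simp: edge_pair_def coordinate_simps)
        then show ?thesis by blast
      next
        case nadj: False
        have "x \<in> edge_pair z x - corner_nbrs \<and> z \<in> edge_pair z x - corner_nbrs \<and> x \<noteq> z"
          using x z False zx by (auto elim!: H_cases simp: edge_pair_def coordinate_simps)
        then show ?thesis using nadj by blast
      qed
    qed
    then show ?thesis unfolding has_stable_2 by blast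
  qed
  have "edge_pair z x \<subseteq> V - {corner}"
    using x z by (auto elim!: H_cases simp: edge_pair_def V_iff coordinate_simps split: if_splits)
  then show "residual 3 (edge_pair z x)" using ns s2 by (simp add: residual_def)
  \<comment> \<open>The other vertex of \<open>R\<close> is not the parent of this one: it is
    \<open>left_of z\<close> where the parent is \<open>up_of z\<close>, or it is
    \<open>up_of x\<close>, which is not even adjacent to \<open>left_of z\<close>.\<close>
  have mR: "lex_max R = (if z = left_of x then left_of z else z)"
    by (rule lex_max_eqI)
       (use x z in \<open>auto elim!: H_cases simp: R_def coordinate_simps split: if_splits\<close>)
  show "\<not> collapsible_remainder (remainder (edge_pair z x))"
    unfolding E(2) collapsible_remainder_def mR
    using x z by (auto elim!: H_cases simp: R_def parent_def coordinate_simps doubleton_eq_iff split: if_splits)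
  show "card (edge_pair z x) = 4"
  proof -
    have "left_of z \<noteq> up_of x" if "z = left_of x"
      using x z that by (auto elim!: H_cases simp: coordinate_simps left_of_def)
    then have "card R = 2" using left_of_H(5)[OF z] by (simp add: R_def)
    moreover have "x \<notin> R" "left_of x \<notin> R"
      using below[of x] below[of "left_of x"] left_of_H(3)[OF x] by (auto simp: lex_less_def)
    moreover have "finite R" by (simp add: R_def)
    ultimately show ?thesis using left_of_H(5)[OF x] by (simp add: EP)
  qed
qed

text \<open>\<open>x\<close> is recovered as the largest vertex, and then \<open>z\<close> from the
  remainder.\<close>

lemma edge_pair_inj:
  assumes "z \<in> H" "x \<in> H" "lex_less z x" "z' \<in> H" "x' \<in> H" "lex_less z' x'"
    and eq: "edge_pair z x = edge_pair z' x'"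
  shows "z = z' \<and> x = x'"
proof
  show x: "x = x'" using edge_pair(3)[OF assms(1-3)] edge_pair(3)[OF assms(4-6)] eq by simp
  have "(if z = left_of x then {left_of z, up_of x} else {z, left_of z}) =
      (if z' = left_of x' then {left_of z', up_of x'} else {z', left_of z'})"
    unfolding edge_pair(5)[OF assms(1-3), symmetric] edge_pair(5)[OF assms(4-6), symmetric] eq ..
  then show "z = z'"
    using assms(1,2,4) x
    by (auto elim!: H_cases simp: coordinate_simps doubleton_eq_iff split: if_splits)
qed

text \<open>The remainder has at least two vertices. With three, all pairs would be adjacent by
  \<open>remainder_pair\<close>, giving a triangle. So it is \<open>{z, s}\<close> with
  \<open>s\<close> below \<open>z\<close>. If they are adjacent, \<open>s\<close> is not the parent
  and hence is \<open>left_of z\<close>, with \<open>z \<in> H\<close>; otherwise they are the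
  exceptional pair, which encodes two horizontal edges meeting in \<open>left_of x\<close>.\<close>

lemma not_collapsible_imp_edge_pair:
  assumes T: "residual 3 T" and h: "horizontal T" and nc: "\<not> collapsible_remainder (remainder T)"
  obtains z x where "z \<in> H" "x \<in> H" "lex_less z x" "T = edge_pair z x"
proof -
  define x where "x = lex_max T"
  define R where "R = remainder T"
  define z where "z = lex_max R"
  note x = residual_horizontal[OF T _ h, folded x_def R_def, simplified]
  note R = remainder_3_nonempty[OF T h, folded R_def]
  have zR: "z \<in> R" and z_max: "\<And>t. t \<in> R \<Longrightarrow> t = z \<or> lex_less t z"
    using lex_max[OF R(2,1)] by (auto simp: z_def)
  note z = x(4)[OF zR]
  have "R \<noteq> {z}" using nc by (auto simp: collapsible_remainder_def R_def z_def)
  then obtain s where s: "s \<in> R" "s \<noteq> z" using zR by blast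
  have sz: "lex_less s z" using z_max s by blast
  note sV = x(4)[OF s(1)]
  have pair: "adj a b \<or> {a, b} = {left_of (left_of x), up_of x}" if "a \<in> R" "b \<in> R" "a \<noteq> b" for a b
    using remainder_pair[OF T h] that by (simp add: R_def x_def)
  have R_eq: "R = {z, s}"
  proof (rule ccontr)
    assume "R \<noteq> {z, s}"
    then obtain t where t: "t \<in> R" "t \<noteq> z" "t \<noteq> s" using zR s by blast
    define l u where "l = left_of (left_of x)" and "u = up_of x"
    note P = pair[folded l_def u_def]
    \<comment> \<open>The exceptional vertices \<open>l\<close> and \<open>u\<close> are at distance
      3, so they have no common neighbour and cannot occur together with a third vertex.\<close>
    have far: "\<not> (adj c l \<and> adj c u)" for c
      using x(1) by (cases c) (auto elim!: H_cases simp: l_def u_def coordinate_simps left_of_def)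
    have special: False if "{a, b} = {l, u}" "c \<in> R" "a \<in> R" "b \<in> R" "a \<noteq> b" "c \<noteq> a" "c \<noteq> b" for a b c
      using P[OF that(2,3,6)] P[OF that(2,4,7)] far[of c] that(1,5-7) by (auto simp: doubleton_eq_iff)
    have "adj z s" using P[OF zR s(1)] special[OF _ t(1) zR s(1)] s t by blast
    moreover have "adj z t" using P[OF zR t(1)] special[OF _ s(1) zR t(1)] s t by blast
    moreover have "adj s t" using P[OF s(1) t(1)] special[OF _ zR s(1) t(1)] s t by blast
    ultimately show False using no_triangle by blast
  qed
  have s_parent: "s \<noteq> parent z" using nc R_eq by (auto simp: collapsible_remainder_def R_def z_def)
  show ?thesis
  proof (cases "adj z s")
    case True
    then have s_eq: "s = left_of z \<and> z \<in> H"
      using sz s_parent sV z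
      by (auto elim!: V_cases simp: adj_Pair lex_less_Pair parent_def left_of_def up_of_def H_iff split: if_splits)
    have "lex_less z x" "z \<noteq> left_of x" using z left_of_H(3)[OF x(1)] by (auto simp: lex_less_def)
    then have "T = edge_pair z x"
      using x(3) R_eq s_eq by (auto simp: edge_pair_def)
    then show ?thesis using that[of z x] s_eq x(1) \<open>lex_less z x\<close> by blast
  next
    case False
    then have eq: "z = left_of (left_of x) \<and> s = up_of x"
      using pair[OF zR s(1)] s(2) sz x(1)
      by (auto elim!: H_cases simp: doubleton_eq_iff coordinate_simps left_of_def)
    have "left_of x \<in> H"
      using eq z x(1) by (auto elim!: H_cases simp: V_iff H_iff left_of_def)
    moreover have "T = edge_pair (left_of x) x"
      using x(3) R_eq eq by (auto simp: edge_pair_def)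
    ultimately show ?thesis using that[of "left_of x" x] x(1) left_of_H(3)[OF x(1)] by blast
  qed
qed

end

section \<open>The matching on the total cut complex\<close>

context grid
begin

text \<open>The base \<open>n + 1\<close> exceeds every second coordinate in \<open>V\<close>, so
  the code respects the lexicographic order there. The constant \<open>bound\<close> is the code of
  the last vertex \<open>(m, n)\<close>.\<close>

definition code :: "vertex \<Rightarrow> int" where
  "code v = int (fst v * (n + 1) + snd v)"

definition bound :: int where
  "bound = int (m * (n + 1) + n)"

lemma code_bounds: "v \<in> V \<Longrightarrow> 0 \<le> code v \<and> code v \<le> bound"
  unfolding code_def bound_def V_iff by (auto intro!: add_mono mult_le_mono)

lemma code_less:
  assumes "u \<in> V" "v \<in> V" "lex_less u v"
  shows "code u < code v"
proof -
  have "fst u * (n + 1) + snd u < fst v * (n + 1) + snd v"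
  proof (cases "fst u < fst v")
    case True
    then have "(fst u + 1) * (n + 1) \<le> fst v * (n + 1)" by (intro mult_le_mono) auto
    moreover have "snd u \<le> n" using assms by (simp add: V_iff)
    ultimately show ?thesis by simp
  next
    case False
    then show ?thesis using assms(3) by (auto simp: lex_less_def)
  qed
  then show ?thesis unfolding code_def by linarith
qed

lemma code_inj:
  assumes "u \<in> V" "v \<in> V" "code u = code v"
  shows "u = v"
proof -
  have "u = v \<or> lex_less u v \<or> lex_less v u" by (auto simp: lex_less_def prod_eq_iff)
  then show ?thesis using code_less[of u v] code_less[of v u] assms by auto
qed

lemma code_lex_max_mono:
  assumes "T \<subseteq> T'" "T \<noteq> {}" "T' \<subseteq> V"
  shows "code (lex_max T) < code (lex_max T') \<or> lex_max T = lex_max T'"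
proof -
  have fin: "finite T" "finite T'" and "T' \<noteq> {}" using assms finite_sub by blast+
  have "lex_max T \<in> T'" "lex_max T' \<in> T'"
    using lex_max(1) assms fin \<open>T' \<noteq> {}\<close> by blast+
  then show ?thesis
    using lex_max(2)[OF fin(2) \<open>T' \<noteq> {}\<close>, of "lex_max T"] code_less assms(3) by blast
qed

lemma mixed_radix:
  fixes a a' c c' M :: int
  assumes c: "0 \<le> c" "c < M" "0 \<le> c'" "c' < M"
  shows "a' < a \<Longrightarrow> a' * M + c' < a * M + c"
    and "a' * M + c' = a * M + c \<Longrightarrow> a' = a \<and> c' = c"
proof -
  have less: "a' * M + c' < a * M + c"
    if "a' < a" "0 \<le> c" "c < M" "0 \<le> c'" "c' < M" for a a' c c' :: int
  proof -
    have "(a' + 1) * M \<le> a * M" using that by (intro mult_right_mono) auto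
    then show ?thesis using that by (simp add: algebra_simps)
  qed
  then show "a' < a \<Longrightarrow> a' * M + c' < a * M + c" using c by blast
  assume eq: "a' * M + c' = a * M + c"
  have "\<not> a' < a" using less[of a' a c c'] c eq by auto
  moreover have "\<not> a < a'" using less[of a a' c' c] c eq by auto
  ultimately have "a' = a" by simp
  then show "a' = a \<and> c' = c" using eq by simp
qed

text \<open>A two-digit number which decreases when \<open>T\<close> grows; the digit \<open>bound + 1\<close> places the sets which
  are not horizontal after all horizontal ones with the same largest vertex.\<close>

definition level :: "vertex set \<Rightarrow> int" where
  "level T = (bound - code (lex_max T)) * (bound + 2) +
     (if horizontal T then bound - code (lex_max (remainder T)) else bound + 1)"

text \<open>For \<open>k = 2\<close> there is no second toggling step, so every horizontal residual
  set is critical.\<close>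

definition matched :: "nat \<Rightarrow> vertex set \<Rightarrow> bool" where
  "matched k T \<longleftrightarrow> horizontal T \<longrightarrow> k = 3 \<and> collapsible_remainder (remainder T)"

definition pivot :: "vertex set \<Rightarrow> vertex" where
  "pivot T = parent (lex_max (if horizontal T then remainder T else T))"

lemma matched_remainder:
  assumes "residual k T" "matched k T" "horizontal T"
  shows "remainder T \<noteq> {}" "lex_max (remainder T) \<in> V"
proof -
  have T: "residual 3 T" using assms by (simp add: matched_def)
  show "remainder T \<noteq> {}" by (rule remainder_3_nonempty(1)[OF T assms(3)])
  then have "lex_max (remainder T) \<in> remainder T"
    using lex_max(1) remainder_3_nonempty(2)[OF T assms(3)] by blast
  then show "lex_max (remainder T) \<in> V" using residual_V[OF T] by (auto simp: remainder_def)
qed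

lemma residual_pivot:
  assumes T: "residual k T" and k: "2 \<le> k" and g: "matched k T"
  shows "pivot T \<in> V" "pivot T \<noteq> corner" "residual k (toggle (pivot T) T)"
    "matched k (toggle (pivot T) T)" "level (toggle (pivot T) T) = level T"
proof -
  consider "\<not> horizontal T" | "horizontal T" "k = 3" "collapsible_remainder (remainder T)"
    using g by (auto simp: matched_def)
  note cases = this
  show "pivot T \<in> V" "pivot T \<noteq> corner" "residual k (toggle (pivot T) T)"
    using cases by (cases; use residual_not_horizontal[OF T k] residual_3_collapsible[of T] T in
        \<open>simp add: pivot_def\<close>)+
  show "matched k (toggle (pivot T) T)" "level (toggle (pivot T) T) = level T"
    using cases by (cases; use residual_not_horizontal[OF T k] residual_3_collapsible[of T] T in
        \<open>simp add: pivot_def matched_def level_def\<close>)+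
qed

text \<open>These ranges explain the base \<open>bound + 2\<close> in \<open>level\<close>:
  differences from \<open>bound\<close> lie between 0 and \<open>bound\<close>, and one further
  digit marks the sets that are not horizontal.\<close>

lemma level_digits:
  assumes T: "residual k T" and k: "2 \<le> k" and g: "matched k T"
  shows "0 \<le> bound - code (lex_max T)"
    "0 \<le> (if horizontal T then bound - code (lex_max (remainder T)) else bound + 1)"
    "(if horizontal T then bound - code (lex_max (remainder T)) else bound + 1) < bound + 2"
    "horizontal T \<Longrightarrow> bound - code (lex_max (remainder T)) < bound + 1"
  using code_bounds[OF residual_lex_max(2)[OF T k]] code_bounds[OF matched_remainder(2)[OF T g]]
  by auto

lemma level_nonneg:
  assumes "residual k T" "2 \<le> k" "matched k T"
  shows "0 \<le> level T"
  using level_digits[OF assms] code_bounds[OF residual_lex_max(2)[OF assms(1,2)]]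
  unfolding level_def by (intro add_nonneg_nonneg mult_nonneg_nonneg) auto

text \<open>Enlarging \<open>T\<close> either raises the largest vertex, which lowers the leading
  digit, or keeps it. In the latter case \<open>horizontal\<close> can only be gained, and the
  remainder grows, so the last digit does not increase.\<close>

lemma level_antimono:
  assumes T: "residual k T" "matched k T" and T': "residual k T'" "matched k T'"
    and k: "2 \<le> k" and sub: "T \<subseteq> T'"
  shows "level T' \<le> level T"
proof -
  note d = level_digits[OF T(1) k T(2)] and d' = level_digits[OF T'(1) k T'(2)]
  have TV: "T' \<subseteq> V" using T'(1) by (auto simp: residual_def)
  consider "code (lex_max T) < code (lex_max T')" | "lex_max T = lex_max T'"
    using code_lex_max_mono[OF sub residual_nonempty[OF T(1) k] TV] by blast
  then show ?thesis
  proof cases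
    case 1
    then have "level T' < level T"
      unfolding level_def by (intro mixed_radix(1) d d') simp
    then show ?thesis by simp
  next
    case 2
    have h: "horizontal T \<Longrightarrow> horizontal T'" using sub 2 by (auto simp: horizontal_def)
    have "bound - code (lex_max (remainder T')) \<le> bound - code (lex_max (remainder T))"
      if hT: "horizontal T"
    proof -
      have "remainder T \<subseteq> remainder T'" using sub 2 by (auto simp: remainder_def)
      moreover have "remainder T' \<subseteq> V" using TV by (auto simp: remainder_def)
      ultimately show ?thesis
        using code_lex_max_mono[OF _ matched_remainder(1)[OF T hT], of "remainder T'"] by auto
    qed
    then have "(if horizontal T' then bound - code (lex_max (remainder T')) else bound + 1) \<le>
        (if horizontal T then bound - code (lex_max (remainder T)) else bound + 1)"
      using h d'(4) by auto
    then show ?thesis unfolding level_def 2 by simp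
  qed
qed

text \<open>The two digits determine whether the set is horizontal and the vertex whose parent is
  the pivot.\<close>

lemma level_pivot:
  assumes T: "residual k T" "matched k T" and T': "residual k T'" "matched k T'"
    and k: "2 \<le> k" and eq: "level T = level T'"
  shows "pivot T = pivot T'"
proof -
  note d = level_digits[OF T(1) k T(2)] and d' = level_digits[OF T'(1) k T'(2)]
  from mixed_radix(2)[OF d'(2,3) d(2,3) eq[unfolded level_def]]
  have c: "code (lex_max T) = code (lex_max T')"
    and r: "(if horizontal T then bound - code (lex_max (remainder T)) else bound + 1) =
      (if horizontal T' then bound - code (lex_max (remainder T')) else bound + 1)" by simp_all
  have m: "lex_max T = lex_max T'"
    using code_inj[OF _ _ c] residual_lex_max(2)[OF T(1) k] residual_lex_max(2)[OF T'(1) k] by simp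
  show ?thesis
  proof (cases "horizontal T")
    case True
    then have h': "horizontal T'" using r d(4) by (auto split: if_splits)
    then have "code (lex_max (remainder T)) = code (lex_max (remainder T'))" using r True by simp
    then have "lex_max (remainder T) = lex_max (remainder T')"
      using code_inj matched_remainder(2)[OF T True] matched_remainder(2)[OF T' h'] by blast
    then show ?thesis using True h' by (simp add: pivot_def)
  next
    case False
    then have "\<not> horizontal T'" using r d'(4) by (auto split: if_splits)
    then show ?thesis using False m by (simp add: pivot_def)
  qed
qed

section \<open>The complete matching on complements of faces\<close>

definition critical :: "nat \<Rightarrow> vertex set set" where
  "critical k = insert corner ` {T. residual k T \<and> \<not> matched k T}"

lemma critical_subset: "1 \<le> k \<Longrightarrow> U \<in> critical k \<Longrightarrow> U \<subseteq> V \<and> has_stable k U \<and> \<not> has_stable k (U - {corner})"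
proof -
  assume k: "1 \<le> k" and "U \<in> critical k"
  then obtain T where T: "residual k T" "U = insert corner T" by (auto simp: critical_def)
  have "U \<subseteq> V" "U - {corner} = T" "corner \<in> U" using T corner_V by (auto simp: residual_def)
  then show ?thesis using residual_iff[of U k] T(1) k by auto
qed

lemma noncritical_cases:
  assumes U: "U \<subseteq> V" "has_stable k U" "U \<notin> critical k" and k: "2 \<le> k"
  obtains "has_stable k (U - {corner})"
  | "\<not> has_stable k (U - {corner})" "corner \<in> U" "residual k (U - {corner})" "matched k (U - {corner})"
proof (cases "has_stable k (U - {corner})")
  case False
  then have R: "corner \<in> U" "residual k (U - {corner})" using residual_iff[of U k] U k by auto
  then have "insert corner (U - {corner}) = U" by auto
  then have "matched k (U - {corner})" using U(3) R(2) unfolding critical_def by (metis (mono_tags, lifting) imageI mem_Collect_eq)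
  then show ?thesis using that(2) False R by blast
qed (use that in blast)

text \<open>The sets matched by the corner are closed under enlargement, so they get the least rank
  0; the shift by 1 keeps the levels, which are nonnegative, apart from it.\<close>

definition set_rank :: "nat \<Rightarrow> vertex set \<Rightarrow> int" where
  "set_rank k U = (if has_stable k (U - {corner}) then 0 else 1 + level (U - {corner}))"

definition set_pivot :: "nat \<Rightarrow> vertex set \<Rightarrow> vertex" where
  "set_pivot k U = (if has_stable k (U - {corner}) then corner else pivot (U - {corner}))"

lemma toggle_noncritical:
  assumes U: "U \<subseteq> V" "has_stable k U" "U \<notin> critical k" and k: "2 \<le> k"
  defines "U' \<equiv> toggle (set_pivot k U) U"
  shows "set_pivot k U \<in> V" "U' \<subseteq> V" "has_stable k U'" "U' \<notin> critical k" "set_rank k U' = set_rank k U"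
proof -
  have "set_pivot k U \<in> V \<and> U' \<subseteq> V \<and> has_stable k U' \<and> U' \<notin> critical k \<and> set_rank k U' = set_rank k U"
    using U k
  proof (cases rule: noncritical_cases)
    case 1
    then have p: "set_pivot k U = corner" by (simp add: set_pivot_def)
    have eq: "U' - {corner} = U - {corner}" unfolding U'_def p by (auto simp: toggle_def)
    have "has_stable k U'" by (rule has_stable_mono[OF 1]) (use eq in blast)
    moreover have "U' \<subseteq> V" using U(1) corner_V eq by blast
    moreover have "U' \<notin> critical k" using critical_subset[of k U'] k eq 1 by auto
    moreover have "set_rank k U' = set_rank k U" unfolding set_rank_def eq ..
    ultimately show ?thesis unfolding p using corner_V by blast
  next
    case 2
    let ?T = "U - {corner}"
    have p: "set_pivot k U = pivot ?T" using 2 by (simp add: set_pivot_def)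
    note P = residual_pivot[OF 2(3) k 2(4)]
    have eq: "U' - {corner} = toggle (pivot ?T) ?T" and c: "corner \<in> U'"
      using P(2) 2(2) unfolding U'_def p by (auto simp: toggle_def)
    have U'V: "U' \<subseteq> V" using P(1) U(1) unfolding U'_def p by (auto simp: toggle_def split: if_splits)
    have st: "has_stable k U' \<and> \<not> has_stable k (U' - {corner})"
      using residual_iff[OF U'V, of k] k c P(3) unfolding eq by simp
    have "U' \<notin> critical k"
    proof
      assume "U' \<in> critical k"
      then obtain T where T: "residual k T" "\<not> matched k T" "U' = insert corner T" by (auto simp: critical_def)
      then have "T = U' - {corner}" using residual_V[OF T(1)] by auto
      then show False using T(2) P(4) unfolding eq by blast
    qed
    moreover have "set_rank k U' = set_rank k U"
      using 2(1) st P(5) unfolding set_rank_def eq by simp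
    ultimately show ?thesis unfolding p using P(1) U'V st by blast
  qed
  then show "set_pivot k U \<in> V" "U' \<subseteq> V" "has_stable k U'" "U' \<notin> critical k" "set_rank k U' = set_rank k U"
    by blast+
qed

lemma set_rank_antimono:
  assumes U: "U \<subseteq> V" "has_stable k U" "U \<notin> critical k"
    and U': "U' \<subseteq> V" "has_stable k U'" "U' \<notin> critical k"
    and k: "2 \<le> k" and sub: "U \<subseteq> U'"
  shows "set_rank k U' \<le> set_rank k U"
  using U' k
proof (cases rule: noncritical_cases)
  case 1
  have "0 \<le> set_rank k U"
    using U k
  proof (cases rule: noncritical_cases)
    case 2
    then show ?thesis using level_nonneg[OF 2(3) k 2(4)] by (simp add: set_rank_def)
  qed (simp add: set_rank_def)
  then show ?thesis using 1 by (simp add: set_rank_def)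
next
  case 2
  have subT: "U - {corner} \<subseteq> U' - {corner}" using sub by blast
  then have n: "\<not> has_stable k (U - {corner})" using 2(1) has_stable_mono by blast
  show ?thesis
    using U k
  proof (cases rule: noncritical_cases)
    case A: 2
    then show ?thesis
      using level_antimono[OF A(3,4) 2(3,4) k subT] 2(1) by (simp add: set_rank_def)
  qed (use n in blast)
qed

lemma set_rank_pivot:
  assumes U: "U \<subseteq> V" "has_stable k U" "U \<notin> critical k"
    and U': "U' \<subseteq> V" "has_stable k U'" "U' \<notin> critical k"
    and k: "2 \<le> k" and eq: "set_rank k U = set_rank k U'"
  shows "set_pivot k U = set_pivot k U'"
  using U' k
proof (cases rule: noncritical_cases)
  case 1
  show ?thesis using U k
  proof (cases rule: noncritical_cases)
    case A: 2
    then show ?thesis using eq 1 level_nonneg[OF A(3) k A(4)] by (simp add: set_rank_def)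
  qed (use 1 in \<open>simp add: set_pivot_def\<close>)
next
  case 2
  show ?thesis using U k
  proof (cases rule: noncritical_cases)
    case 1
    then show ?thesis using eq 2(1) level_nonneg[OF 2(3) k 2(4)] by (simp add: set_rank_def)
  next
    case A: 2
    then have "level (U - {corner}) = level (U' - {corner})" using eq 2(1) by (simp add: set_rank_def)
    then show ?thesis
      using level_pivot[OF A(3,4) 2(3,4) k] A(1) 2(1) by (simp add: set_pivot_def)
  qed
qed

section \<open>Counting the critical sets\<close>

lemma card_critical: "card (critical k) = card {T. residual k T \<and> \<not> matched k T}"
proof -
  have "inj_on (insert corner) {T. residual k T \<and> \<not> matched k T}"
  proof (rule inj_onI)
    fix S T
    assume S: "S \<in> {T. residual k T \<and> \<not> matched k T}" and T: "T \<in> {T. residual k T \<and> \<not> matched k T}"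
    have n: "corner \<notin> S" "corner \<notin> T" using residual_V[of k S corner] residual_V[of k T corner] S T by blast+
    assume "insert corner S = insert corner T"
    then show "S = T" by (rule insert_ident[OF n, THEN iffD1])
  qed
  then show ?thesis unfolding critical_def by (rule card_image)
qed

lemma critical_2:
  "card (critical 2) = (m - 1) * (n - 1)" "U \<in> critical 2 \<Longrightarrow> card U = 3"
proof -
  have eq: "{T. residual 2 T \<and> \<not> matched 2 T} = (\<lambda>x. {x, left_of x}) ` H"
    using residual_2_horizontal_iff by (auto simp: matched_def)
  have "inj_on (\<lambda>x. {x, left_of x}) H"
    by (rule inj_onI) (auto elim!: H_cases simp: coordinate_simps doubleton_eq_iff)
  then show "card (critical 2) = (m - 1) * (n - 1)"
    unfolding card_critical eq by (simp add: card_image card_H)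
  assume "U \<in> critical 2"
  then obtain x where "x \<in> H" "U = insert corner {x, left_of x}"
    unfolding critical_def eq by blast
  then show "card U = 3"
    using left_of_H[of x] by (auto simp: H_iff card_insert_if)
qed

text \<open>The lexicographic order is total, so every 2-subset of \<open>H\<close> has exactly one
  increasing arrangement.\<close>

lemma card_ordered_pairs: "card {(z, x). z \<in> H \<and> x \<in> H \<and> lex_less z x} = card H choose 2"
proof -
  let ?f = "\<lambda>(z, x). {z, x}"
  let ?P = "{(z, x). z \<in> H \<and> x \<in> H \<and> lex_less z x}"
  have "bij_betw ?f ?P {A. A \<subseteq> H \<and> card A = 2}"
    unfolding bij_betw_def
  proof
    show "inj_on ?f ?P"
      by (rule inj_onI) (auto simp: doubleton_eq_iff lex_less_def)
    show "?f ` ?P = {A. A \<subseteq> H \<and> card A = 2}"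
    proof (intro equalityI subsetI)
      fix A assume "A \<in> {A. A \<subseteq> H \<and> card A = 2}"
      then obtain a b where ab: "A = {a, b}" "a \<noteq> b" "a \<in> H" "b \<in> H" by (auto simp: card_2_iff)
      have "lex_less a b \<or> lex_less b a" using ab(2) by (auto simp: lex_less_def prod_eq_iff)
      then obtain z x where zx: "z \<in> H" "x \<in> H" "lex_less z x" "A = {z, x}"
      proof
        assume "lex_less a b"
        then show ?thesis using that[of a b] ab by blast
      next
        assume "lex_less b a"
        then show ?thesis using that[of b a] ab by blast
      qed
      then show "A \<in> ?f ` ?P" by (intro image_eqI[of _ _ "(z, x)"]) simp_all
    qed (auto simp: lex_less_def card_insert_if)
  qed
  then have "card ?P = card {A. A \<subseteq> H \<and> card A = 2}" by (rule bij_betw_same_card)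
  also have "\<dots> = card H choose 2" by (rule n_subsets) (simp add: H_def)
  finally show ?thesis .
qed

lemma critical_3:
  "card (critical 3) = ((m - 1) * (n - 1)) choose 2" "U \<in> critical 3 \<Longrightarrow> card U = 5"
proof -
  let ?f = "\<lambda>(z, x). edge_pair z x"
  let ?P = "{(z, x). z \<in> H \<and> x \<in> H \<and> lex_less z x}"
  have eq: "{T. residual 3 T \<and> \<not> matched 3 T} = ?f ` ?P"
  proof (intro equalityI subsetI)
    fix T assume "T \<in> {T. residual 3 T \<and> \<not> matched 3 T}"
    then have T: "residual 3 T" "horizontal T" "\<not> collapsible_remainder (remainder T)"
      by (auto simp: matched_def)
    then obtain z x where "z \<in> H" "x \<in> H" "lex_less z x" "T = edge_pair z x"
      by (rule not_collapsible_imp_edge_pair)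
    then show "T \<in> ?f ` ?P" by (intro image_eqI[of _ _ "(z, x)"]) auto
  next
    fix T assume "T \<in> ?f ` ?P"
    then obtain z x where "z \<in> H" "x \<in> H" "lex_less z x" "T = edge_pair z x" by auto
    then show "T \<in> {T. residual 3 T \<and> \<not> matched 3 T}" using edge_pair[of z x] by (simp add: matched_def)
  qed
  have "inj_on ?f ?P"
  proof (rule inj_onI)
    fix p q assume pq: "p \<in> ?P" "q \<in> ?P" "?f p = ?f q"
    obtain z x z' x' where "p = (z, x)" "q = (z', x')" by (metis surj_pair)
    then show "p = q" using pq edge_pair_inj[of z x z' x'] by auto
  qed
  then show "card (critical 3) = ((m - 1) * (n - 1)) choose 2"
    unfolding card_critical eq by (simp only: card_image card_ordered_pairs card_H)
  assume "U \<in> critical 3"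
  then obtain T where T: "U = insert corner T" "residual 3 T" "T \<in> ?f ` ?P"
    unfolding critical_def eq[symmetric] by blast
  then have "card T = 4" using edge_pair(6) by auto
  moreover have "corner \<notin> T" using residual_V[OF T(2)] by blast
  ultimately show "card U = 5" using residual_finite[OF T(2)] T(1) by simp
qed

text \<open>Complementation turns the antitone \<open>set_rank\<close> into a monotone rank on
  faces. The assumption \<open>full\<close> says that \<open>V\<close>, the complement of the empty
  face, is matched by the corner and so is not critical.\<close>

lemma total_cut_complex_wedge:
  assumes k: "2 \<le> k" and d: "d + 2 * k = m * n"
    and crit: "\<And>U. U \<in> critical k \<Longrightarrow> card U = 2 * k - 1"
    and full: "has_stable k (V - {corner})"
  shows "geometric_realization (total_cut_complex k (grid_graph m n)) homotopy_equivalent_space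
    wedge_sum (\<lambda>_. nsphere d) (\<lambda>_. nsphere_base) {..<card (critical k)}"
proof -
  define K where "K = {W. W \<subseteq> V \<and> has_stable k (V - W)}"
  define C where "C = (\<lambda>U. V - U) ` critical k"
  have crit_V: "U \<subseteq> V \<and> has_stable k U" if "U \<in> critical k" for U
    using critical_subset[of k U] k that by simp
  have C_iff: "W \<in> C \<longleftrightarrow> V - W \<in> critical k" if "W \<subseteq> V" for W
  proof
    assume "V - W \<in> critical k"
    moreover have "W = V - (V - W)" using that by blast
    ultimately show "W \<in> C" unfolding C_def by blast
  next
    assume "W \<in> C"
    then obtain U where "U \<in> critical k" "W = V - U" by (auto simp: C_def)
    moreover from this have "V - W = U" using crit_V by blast
    ultimately show "V - W \<in> critical k" by simp
  qed
  have KC: "W \<subseteq> V \<and> V - W \<subseteq> V \<and> has_stable k (V - W) \<and> V - W \<notin> critical k" if "W \<in> K - C" for W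
    using that C_iff[of W] by (auto simp: K_def)
  have tog: "V - toggle p W = toggle p (V - W)" if "p \<in> V" for p W
    using that by (auto simp: toggle_def)
  have "ranked_matching K C (\<lambda>W. set_rank k (V - W)) (\<lambda>W. set_pivot k (V - W))"
    unfolding ranked_matching_def
  proof (intro conjI ballI impI)
    show "C \<subseteq> K"
    proof
      fix W assume "W \<in> C"
      then obtain U where "U \<in> critical k" "W = V - U" by (auto simp: C_def)
      moreover from this have "V - W = U" using crit_V by blast
      ultimately show "W \<in> K" using crit_V by (auto simp: K_def)
    qed
    fix W assume W: "W \<in> K - C"
    let ?p = "set_pivot k (V - W)"
    have t: "?p \<in> V" "toggle ?p (V - W) \<subseteq> V" "has_stable k (toggle ?p (V - W))"
      "toggle ?p (V - W) \<notin> critical k" "set_rank k (toggle ?p (V - W)) = set_rank k (V - W)"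
      using toggle_noncritical[of "V - W" k] KC[OF W] k by blast+
    have "toggle ?p W \<subseteq> V" using KC[OF W] t(1) by (auto simp: toggle_def)
    then show "toggle ?p W \<in> K - C"
      using t C_iff[of "toggle ?p W"] by (simp add: K_def tog[OF t(1)])
    show "set_rank k (V - toggle ?p W) = set_rank k (V - W)"
      using t by (simp add: tog[OF t(1)])
    fix W' assume W': "W' \<in> K - C"
    show "set_rank k (V - W) \<le> set_rank k (V - W')" if "W \<subseteq> W'"
      by (rule set_rank_antimono) (use KC[OF W] KC[OF W'] k that in blast)+
    show "?p = set_pivot k (V - W')" if "set_rank k (V - W) = set_rank k (V - W')"
      by (rule set_rank_pivot) (use KC[OF W] KC[OF W'] k that in blast)+
  qed
  moreover have "K = total_cut_complex k (grid_graph m n)" by (simp add: K_def total_cut_complex_eq)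
  moreover have "abstract_simplicial_complex K"
    unfolding \<open>K = total_cut_complex k (grid_graph m n)\<close>
    by (rule abstract_simplicial_complex_total_cut_complex) (simp add: grid_graph_def)
  moreover have "finite K" using finite_V by (simp add: K_def)
  moreover have "{} \<in> K - C"
  proof -
    have "has_stable k V" by (rule has_stable_mono[OF full]) blast
    moreover have "V \<notin> critical k" using critical_subset[of k V] k full by auto
    ultimately show ?thesis using C_iff[of "{}"] by (simp add: K_def)
  qed
  \<comment> \<open>A critical complement has \<open>2 * k - 1\<close> vertices, so the face has
    \<open>m * n - 2 * k + 1 = d + 1\<close> vertices and dimension \<open>d\<close>.\<close>
  moreover have "card W = d + 1" if W: "W \<in> C" for W
  proof -
    obtain U where U: "U \<in> critical k" "W = V - U" using W by (auto simp: C_def)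
    then have "card W = m * n - (2 * k - 1)"
      using crit[OF U(1)] crit_V[OF U(1)] finite_sub by (simp add: card_Diff_subset card_V)
    then show ?thesis using d k by simp
  qed
  moreover have "card C = card (critical k)"
  proof -
    have "inj_on (\<lambda>U. V - U) (critical k)"
      by (rule inj_onI) (metis crit_V double_diff subset_refl)
    then show ?thesis by (simp add: C_def card_image)
  qed
  ultimately show ?thesis
    using ranked_matching_wedge[of K C _ _ d] by metis
qed

text \<open>Two edges cover all four vertices. This is the only case of the theorem with negative
  sphere dimension.\<close>

lemma total_cut_complex_2x2: "m = 2 \<Longrightarrow> n = 2 \<Longrightarrow> total_cut_complex 3 (grid_graph m n) = {}"
proof -
  assume mn: "m = 2" "n = 2"
  have "V \<subseteq> {(1, 1), (1, 2), (2, 1), (2, 2)}"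
  proof
    fix v assume "v \<in> V"
    then have "1 \<le> fst v" "fst v \<le> m" "1 \<le> snd v" "snd v \<le> n" unfolding V_iff by blast+
    then have "fst v = 1 \<or> fst v = 2" "snd v = 1 \<or> snd v = 2" using mn(1,2) by linarith+
    then show "v \<in> {(1, 1), (1, 2), (2, 1), (2, 2)}" by (cases v) auto
  qed
  moreover have "\<not> has_stable 3 {(1, 1), (1, 2), (2, 1), (2, 2)}"
    by (rule no_stable_3_two_edges) (auto simp: adj_Pair)
  ultimately have "\<not> has_stable 3 V" using has_stable_mono by blast
  then have "\<not> has_stable 3 (V - W)" for W using has_stable_mono[of 3 "V - W" V] by blast
  then show ?thesis unfolding total_cut_complex_eq by blast
qed

lemma has_stable_full:
  "has_stable 2 (V - {corner})" "m \<noteq> 2 \<or> n \<noteq> 2 \<Longrightarrow> has_stable 3 (V - {corner})"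
proof -
  have "(1, 2) \<in> V - {corner} \<and> (2, 1) \<in> V - {corner} \<and> (1, 2) \<noteq> (2::nat, 1::nat) \<and> \<not> adj (1, 2) (2, 1)"
    using m2 n2 by (simp add: V_iff adj_Pair)
  then show "has_stable 2 (V - {corner})" unfolding has_stable_2 by blast
  assume ne: "m \<noteq> 2 \<or> n \<noteq> 2"
  \<comment> \<open>A third vertex of the same checkerboard colour as \<open>(1, 2)\<close> and
    \<open>(2, 1)\<close>, placed in whichever direction the grid has length at least 3.\<close>
  define c where "c = (if m \<noteq> 2 then (3, 2) else (2::nat, 3::nat))"
  have "(1, 2) \<in> V - {corner} \<and> (2, 1) \<in> V - {corner} \<and> c \<in> V - {corner} \<and>
    (1, 2) \<noteq> (2::nat, 1::nat) \<and> (1, 2) \<noteq> c \<and> (2, 1) \<noteq> c \<and>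
    \<not> adj (1, 2) (2, 1) \<and> \<not> adj (1, 2) c \<and> \<not> adj (2, 1) c"
    using m2 n2 ne by (auto simp: c_def V_iff adj_Pair)
  then show "has_stable 3 (V - {corner})" unfolding has_stable_3 by blast
qed

end

theorem corollary4:
  fixes m n k :: nat
  assumes "m \<ge> 2" and "n \<ge> 2" and "k \<in> {2, 3}"
  shows "geometric_realization (total_cut_complex k (grid_graph m n)) homotopy_equivalent_space
    wedge_of_spheres (((m - 1) * (n - 1)) choose (k - 1)) (int (m * n) - 2 * int k)"
proof -
  interpret grid m n by unfold_locales (use assms in auto)
  show ?thesis
  proof (cases "m = 2 \<and> n = 2 \<and> k = 3")
    \<comment> \<open>The void complex has empty realization, and the dimension
      \<open>4 - 6 = -2\<close> makes the wedge empty by convention.\<close>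
    case True
    then have "geometric_realization (total_cut_complex k (grid_graph m n)) = trivial_topology"
      using total_cut_complex_2x2 by (simp add: geometric_realization_def)
    moreover have "wedge_of_spheres (((m - 1) * (n - 1)) choose (k - 1)) (int (m * n) - 2 * int k) = trivial_topology"
      using True by (simp add: wedge_of_spheres_def)
    ultimately show ?thesis
      by (simp add: homeomorphic_imp_homotopy_equivalent_space homeomorphic_empty_space_eq)
  next
    case False
    have "2 * k \<le> m * n"
    proof (cases "k = 2")
      case True
      then show ?thesis using mult_le_mono[OF assms(1,2)] by simp
    next
      case k: False
      then have "3 * 2 \<le> m * n \<or> 2 * 3 \<le> m * n"
        using False assms mult_le_mono[of 3 m 2 n] mult_le_mono[of 2 m 3 n] by auto
      then show ?thesis using k assms(3) by auto
    qed
    then obtain d where d: "d + 2 * k = m * n" by (metis le_add_diff_inverse2)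
    have "card U = 2 * k - 1" if "U \<in> critical k" for U
      using that critical_2(2)[of U] critical_3(2)[of U] assms(3) by auto
    moreover have "has_stable k (V - {corner})" using has_stable_full False assms(3) by auto
    moreover have "2 \<le> k" using assms(3) by auto
    ultimately have "geometric_realization (total_cut_complex k (grid_graph m n)) homotopy_equivalent_space
      wedge_sum (\<lambda>_. nsphere d) (\<lambda>_. nsphere_base) {..<card (critical k)}"
      using total_cut_complex_wedge d by blast
    moreover have "card (critical k) = ((m - 1) * (n - 1)) choose (k - 1)"
      using critical_2(1) critical_3(1) assms(3) by auto
    moreover have "int (m * n) - 2 * int k = int d" using d by linarith
    ultimately show ?thesis by (simp add: wedge_of_spheres_def)
  qed
qed

end
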